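(* Let $k,\ell \geq 3$ be odd integers and let $n = \frac{k\ell+1}{2}$. The edges of the bumpy wheel $BW_{k,\ell}$ cannot be partitioned into $n$ plane spanning trees if and only if $\ell > 3$.
   Context: A geometric graph is a graph drawn in the plane whose vertices are points in general position (no three collinear) and whose edges are straight-line segments; it is plane if no two edges cross, i.e. share a point of their relative interiors (sharing an endpoint is allowed). A partition of a graph $G$ is a set of edge-disjoint subgraphs whose union is $G$; a spanning tree is a tree containing all vertices of $G$. For odd integers $k,\ell\ge 3$, the bumpy wheel $BW_{k,\ell}$ is the complete geometric graph on the following set of $k\ell+1$ points: take a regular $k$-gon with center $v_0$ and replace each of its $k$ vertices by a group of $\ell$ points that are $\varepsilon$-close for a sufficiently small $\varepsilon>0$, such that all $k\ell$ points other than $v_0$ lie on the convex hull (in convex position), $v_0$ is the only interior point, and the convex hull of any $\frac{k+1}{2}$ consecutive groups does not contain $v_0$. *)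

theory Defs
  imports "HOL-Analysis.Analysis"
begin

section \<open>Simple graphs\<close>

text \<open>A graph is a pair of a vertex set and a set of two-element vertex sets.\<close>

type_synonym 'a graph = "'a set \<times> 'a set set"

abbreviation verts :: "'a graph \<Rightarrow> 'a set" where "verts \<equiv> fst"
abbreviation edges :: "'a graph \<Rightarrow> 'a set set" where "edges \<equiv> snd"

definition simple_graph :: "'a graph \<Rightarrow> bool" where
  "simple_graph G \<longleftrightarrow> edges G \<subseteq> {e. e \<subseteq> verts G \<and> card e = 2}"

definition complete_graph :: "'a set \<Rightarrow> 'a graph" where
  "complete_graph V = (V, {e. e \<subseteq> V \<and> card e = 2})"

definition subgraph :: "'a graph \<Rightarrow> 'a graph \<Rightarrow> bool" where
  "subgraph H G \<longleftrightarrow> simple_graph H \<and> verts H \<subseteq> verts G \<and> edges H \<subseteq> edges G"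

definition graph_connected :: "'a graph \<Rightarrow> bool" where
  "graph_connected G \<longleftrightarrow> verts G \<noteq> {} \<and>
     (\<forall>u\<in>verts G. \<forall>v\<in>verts G. (u, v) \<in> {(x, y). {x, y} \<in> edges G}\<^sup>*)"

definition graph_cycle :: "'a graph \<Rightarrow> 'a list \<Rightarrow> bool" where
  "graph_cycle G c \<longleftrightarrow> length c \<ge> 3 \<and> distinct c \<and>
     (\<forall>i<length c. {c ! i, c ! (Suc i mod length c)} \<in> edges G)"

definition tree :: "'a graph \<Rightarrow> bool" where
  "tree G \<longleftrightarrow> simple_graph G \<and> graph_connected G \<and> (\<nexists>c. graph_cycle G c)"

definition spanning_tree :: "'a graph \<Rightarrow> 'a graph \<Rightarrow> bool" where
  "spanning_tree T G \<longleftrightarrow> subgraph T G \<and> verts T = verts G \<and> tree T"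

definition graph_partition :: "'a graph \<Rightarrow> 'a graph set \<Rightarrow> bool" where
  "graph_partition G P \<longleftrightarrow>
     (\<forall>H\<in>P. subgraph H G) \<and>
     (\<forall>H\<in>P. \<forall>H'\<in>P. H \<noteq> H' \<longrightarrow> edges H \<inter> edges H' = {}) \<and>
     \<Union> (verts ` P) = verts G \<and> \<Union> (edges ` P) = edges G"

section \<open>Geometric graphs\<close>

text \<open>
  The Euclidean plane is the type \<^typ>\<open>complex\<close>. In a geometric graph, the edge
  \<open>{a, b}\<close> is drawn as the segment \<open>convex hull {a, b}\<close>.
\<close>

definition general_position :: "complex set \<Rightarrow> bool" where
  "general_position S \<longleftrightarrow>
     (\<forall>x\<in>S. \<forall>y\<in>S. \<forall>z\<in>S. x \<noteq> y \<and> y \<noteq> z \<and> x \<noteq> z \<longrightarrow> \<not> collinear {x, y, z})"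

definition edges_cross :: "complex set \<Rightarrow> complex set \<Rightarrow> bool" where
  "edges_cross e f \<longleftrightarrow> e \<noteq> f \<and>
     rel_interior (convex hull e) \<inter> rel_interior (convex hull f) \<noteq> {}"

definition plane_graph :: "complex graph \<Rightarrow> bool" where
  "plane_graph G \<longleftrightarrow> (\<forall>e\<in>edges G. \<forall>f\<in>edges G. \<not> edges_cross e f)"

section \<open>Bumpy wheels\<close>

text \<open>
  Every regular \<open>k\<close>-gon with center \<open>v0\<close> arises from some \<open>w \<noteq> 0\<close>, the position of one
  vertex relative to the center.
\<close>

definition kgon_vertex :: "nat \<Rightarrow> complex \<Rightarrow> complex \<Rightarrow> nat \<Rightarrow> complex" where
  "kgon_vertex k v0 w i = v0 + w * cis (2 * pi * real i / real k)"

text \<open>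
  \<open>V\<close> is the vertex set of a bumpy wheel with parameters \<open>k\<close>, \<open>l\<close> and \<open>\<epsilon>\<close>;
  \<open>A i\<close> is the group of points replacing the \<open>i\<close>-th vertex of the \<open>k\<close>-gon.
  The cardinality of \<open>V\<close> forces the groups to be pairwise disjoint and \<open>v0\<close>-free.
  How small \<open>\<epsilon>\<close> has to be is not part of this predicate.
\<close>

definition bumpy_wheel ::
  "nat \<Rightarrow> nat \<Rightarrow> complex \<Rightarrow> complex \<Rightarrow> real \<Rightarrow> complex set \<Rightarrow> bool" where
  "bumpy_wheel k l v0 w \<epsilon> V \<longleftrightarrow>
     (\<exists>A :: nat \<Rightarrow> complex set.
        V = insert v0 (\<Union>i<k. A i) \<and>
        card V = k * l + 1 \<and>
        (\<forall>i<k. card (A i) = l \<and> (\<forall>x\<in>A i. dist x (kgon_vertex k v0 w i) \<le> \<epsilon>)) \<and>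
        general_position V \<and>
        (\<forall>x\<in>V - {v0}. x extreme_point_of (convex hull V)) \<and>
        v0 \<in> interior (convex hull V) \<and>
        (\<forall>i<k. v0 \<notin> convex hull (\<Union>m<(k + 1) div 2. A ((i + m) mod k))))"

end

theory Submission
  imports Defs
begin

text \<open>
  Write \<open>k = 2 * h + 1\<close>, \<open>H = h * l\<close> and \<open>N = k * l\<close>. An outer edge cuts off an arc of the hull not seen from
  the centre, and the arcs of a plane tree are laminar. By connectedness every arc of a plane spanning
  tree contains a boundary edge of the tree, and arcs of length \<open>H\<close> of the same tree are disjoint; so a tree
  has at least as many boundary edges as arcs of length \<open>H\<close>. There are \<open>N\<close> edges of either kind, hence equality
  holds for each tree of a partition. A tree has at most two arcs of length \<open>H\<close> and \<open>N = 2 * n - 1\<close>, so one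
  tree \<open>T0\<close> has one boundary edge and the others have two. This makes the trees zigzags below their longest
  arcs, which leaves few vertices available for radial edges. Let \<open>A\<close>, \<open>B\<close> be the two groups joined by the arc
  of length \<open>H\<close> of \<open>T0\<close>, and count the radial edges that do not end at one of the \<open>2 * (l - 2)\<close> points
  of \<open>A\<close> and \<open>B\<close> other than the first and last point of these groups. \<open>T0\<close> has at least \<open>H + 1\<close> of them,
  each of the \<open>n - l\<close> trees without an arc of length \<open>H\<close> from \<open>A\<close> to \<open>B\<close> has one, and so has a tree
  in which such an arc is maximal. Comparing with \<open>N - 2 * (l - 2)\<close> gives \<open>l \<le> 3\<close>.

  For \<open>l = 3\<close> every inequality above is tight, which determines the trees almost completely; the partition
  below is read off from that analysis. Its trees cover all edges, so by counting they are disjoint.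
\<close>

section \<open>Combinatorics of a single tree\<close>

text \<open>The points left out of the final count are where a tree can hide its only radial edge.
  The two arcs of length \<open>H\<close> of a tree other than \<open>T0\<close> can be ordered so
  that one leads from a group \<open>g\<close> to \<open>g + h\<close> and the other from
  \<open>g + h\<close> on to \<open>g + 2 * h\<close>; both may be extended so far that only the
  middle group \<open>g + h\<close> still sees the centre. If one of them leads from
  \<open>A\<close> to \<open>B\<close>, the middle group is \<open>A\<close> or \<open>B\<close>, so
  such a tree is in general charged nothing; for all other trees it is a different group, and their
  radial edge is counted. The maximal arc is found by pigeonhole: \<open>l\<close> arcs of length
  \<open>H\<close> lead from \<open>A\<close> to \<open>B\<close>, but only \<open>l - 1\<close> of
  length \<open>H + 1\<close>, and by peeling every longer arc around one of the former contains one
  of the latter. It is not an arc of \<open>T0\<close>, since \<open>T0\<close> would then take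
  \<open>N - H\<close> radial edges and leave too few for the other trees. The count
  \<open>(H + 1) + 1 + (n - l) \<le> N - 2 * (l - 2)\<close> with
  \<open>2 * n = N + 1 = 2 * H + l + 1\<close> is exactly \<open>l \<le> 3\<close>.\<close>

lemma periodic_mult:
  fixes f :: "int \<Rightarrow> 'b" and N c :: int
  assumes "\<And>x. f (x + N) = f x"
  shows "f (x + c * N) = f x"
proof -
  have *: "f (x + int n * N) = f x" for n x
  proof (induction n)
    case (Suc n)
    have "f (x + int (Suc n) * N) = f (x + int n * N + N)" by (simp add: algebra_simps)
    then show ?case using Suc assms by simp
  qed simp
  show ?thesis
  proof (cases "c \<ge> 0")
    case True then show ?thesis using *[of x "nat c"] by simp
  next
    case False then show ?thesis using *[of "x + c * N" "nat (-c)"] by simp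
  qed
qed

locale wheel_index =
  fixes h l N H :: int
  assumes h_pos: "h \<ge> 1" and l_ge: "l \<ge> 3"
    and H_def: "H = h * l" and N_def: "N = 2 * H + l"
begin

lemma H_ge: "H \<ge> l"
  using h_pos l_ge mult_right_mono[of 1 h l] by (simp add: H_def)

lemma N_pos: "N > 0" using H_ge l_ge by (simp add: N_def)

lemma N_eq: "N = (2 * h + 1) * l"
  by (simp add: N_def H_def algebra_simps)

lemma multiple_N_cases: "c = 0 \<or> c * N \<ge> N \<or> c * N \<le> - N"
proof -
  have "N > 0" using H_ge l_ge by (simp add: N_def)
  consider "c = 0" | "c \<ge> 1" | "c \<le> -1" by linarith
  then show ?thesis
  proof cases
    case 2 then show ?thesis using mult_right_mono[of 1 c N] \<open>N > 0\<close> by simp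
  next
    case 3 then show ?thesis using mult_right_mono[of c "-1" N] \<open>N > 0\<close> by simp
  qed simp
qed

lemma div_add_H [simp]: "(p + H) div l = p div l + h"
  using l_ge by (simp add: H_def)

lemma div_add_N: "(p + c * N) div l = p div l + c * (2 * h + 1)"
proof -
  have "p + c * N = p + (c * (2 * h + 1)) * l" by (simp add: N_eq)
  then show ?thesis using l_ge by (simp only: div_mult_self1)
qed

text \<open>The group distances along the two sides of a chord add up to the odd number
  \<open>2 * h + 1\<close>, so one of them is at most \<open>h\<close>; that side faces away from
  the centre.\<close>

lemma short_or: "q \<le> p + N \<Longrightarrow> q div l \<le> p div l + h \<or> (p + N) div l \<le> q div l + h"
  using div_add_N[of p 1] by auto

lemma short_less: "q div l \<le> p div l + h \<Longrightarrow> q < p + N"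
  using div_add_N[of p 1] zdiv_mono1[of "p + N" q l] l_ge h_pos by fastforce

lemma periodic_window:
  assumes "\<And>x. f (x + N) = f x"
  shows "\<exists>t. r \<le> t \<and> t < r + N \<and> f t = f s"
proof -
  have "s = r + (s - r) mod N + (s - r) div N * N" by simp
  then have "f s = f (r + (s - r) mod N)" using periodic_mult[of f, OF assms] by metis
  then show ?thesis using N_pos by (intro exI[of _ "r + (s - r) mod N"]) auto
qed

lemma le_div_iff: "i \<le> p div l \<longleftrightarrow> i * l \<le> p"
proof
  assume "i \<le> p div l"
  then have "i * l \<le> (p div l) * l" using l_ge by (intro mult_right_mono) auto
  also have "\<dots> \<le> p" using l_ge pos_mod_sign[of l p] by (simp add: minus_mod_eq_div_mult[symmetric])
  finally show "i * l \<le> p" .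
next
  assume "i * l \<le> p"
  then have "(i * l) div l \<le> p div l" using l_ge by (intro zdiv_mono1) auto
  then show "i \<le> p div l" using l_ge by simp
qed

lemma mod_last: "(l - 1 + l * c) mod l = l - 1"
  using l_ge mod_pos_pos_trivial[of "l - 1" l] by simp

lemma div_le_iff: "p div l \<le> i \<longleftrightarrow> p < i * l + l"
  using le_div_iff[of "i + 1" p] by (auto simp: algebra_simps)

lemma div_eq_iff: "p div l = i \<longleftrightarrow> i * l \<le> p \<and> p < i * l + l"
  using div_le_iff le_div_iff by (meson order_antisym order_refl)

end

text \<open>
  A plane spanning tree seen from the cyclic order of the outer points, which are indexed periodically by
  the integers with period \<open>N\<close>: group \<open>i\<close> consists of \<open>i * l, \<dots>, i * l + l - 1\<close>, \<open>arc p q\<close> says that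
  \<open>{p, q}\<close> is an edge having the points strictly between \<open>p\<close> and \<open>q\<close> on the side away from the centre, and
  \<open>rad r\<close> that \<open>r\<close> is joined to the centre. The assumption \<open>exit\<close> is connectedness for intervals.
\<close>

locale wheel_tree = wheel_index +
  fixes arc :: "int \<Rightarrow> int \<Rightarrow> bool" and rad :: "int \<Rightarrow> bool"
  assumes arc_less: "arc p q \<Longrightarrow> p < q"
    and arc_short: "arc p q \<Longrightarrow> q div l \<le> p div l + h"
    and arc_period: "arc (p + N) (q + N) \<longleftrightarrow> arc p q"
    and rad_period: "rad (r + N) \<longleftrightarrow> rad r"
    and laminar: "\<lbrakk>arc p q; arc r s; p < r; r < q\<rbrakk> \<Longrightarrow> s \<le> q"
    and rad_outside: "\<lbrakk>arc p q; p < r; r < q\<rbrakk> \<Longrightarrow> \<not> rad r"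
    and exit: "\<lbrakk>x \<le> y; y < x + N\<rbrakk> \<Longrightarrow> \<exists>r. x \<le> r \<and> r \<le> y \<and>
      (rad r \<or> (\<exists>t. y < t \<and> t < x + N \<and> arc r t) \<or> (\<exists>t. t < x \<and> y < t + N \<and> arc t r))"
    and no_triangle: "\<lbrakk>arc p q; arc q r\<rbrakk> \<Longrightarrow> \<not> arc r (p + N)"
begin

lemma arc_period_mult: "arc (p + c * N) (q + c * N) \<longleftrightarrow> arc p q"
  using periodic_mult[of "\<lambda>x. arc (p + x) (q + x)" N 0 c] arc_period by (simp add: add.assoc[symmetric])

lemma rad_period_mult: "rad (r + c * N) \<longleftrightarrow> rad r"
  using rad_period by (rule periodic_mult)

lemma rad_mod: "rad (r mod N) \<longleftrightarrow> rad r"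
  using rad_period_mult[of r "- (r div N)"] by (simp add: minus_div_mult_eq_mod[symmetric])

text \<open>For an interval containing all \<open>N\<close> outer points, \<open>exit\<close> has no
  outer target left.\<close>

lemma ex_rad: "\<exists>r. x \<le> r \<and> r < x + N \<and> rad r"
  using exit[of x "x + N - 1"] H_ge l_ge by (auto simp: N_def)

lemma exit1:
  "rad x \<or> (\<exists>t. x < t \<and> t < x + N \<and> arc x t) \<or> (\<exists>t. t < x \<and> x < t + N \<and> arc t x)"
  using exit[of x x] N_pos by (metis order_antisym order_refl add_less_same_cancel1 less_add_same_cancel1)

lemma arc_length: "arc p q \<Longrightarrow> q - p < H + l"
  using arc_short[of p q] div_le_iff[of q "p div l + h"] le_div_iff[of "p div l" p]
  by (simp add: H_def algebra_simps)

text \<open>Both arcs cover the step from \<open>t\<close> to \<open>t + 1\<close>, so they are not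
  disjoint and laminarity leaves only containment.\<close>

lemma nested:
  assumes "arc p q" "arc r s" "p \<le> t" "t < q" "r \<le> t" "t < s"
  shows "p \<le> r \<and> s \<le> q \<or> r \<le> p \<and> q \<le> s"
  using laminar[OF assms(1,2)] laminar[OF assms(2,1)] assms(3-) by linarith

text \<open>Descent on the length: \<open>p + 1\<close> has no radial edge, so it is joined to
  \<open>p\<close> or starts a shorter arc below the given one.\<close>

lemma ex_boundary: "arc p q \<Longrightarrow> \<exists>r. p \<le> r \<and> r < q \<and> arc r (r + 1)"
proof (induction "nat (q - p)" arbitrary: p q rule: less_induct)
  case less
  have "p < q" using arc_less less.prems by blast
  show ?case
  proof (cases "q = p + 1")
    case True then show ?thesis using less.prems by auto
  next
    case False
    then have *: "p < p + 1" "p + 1 < q" using \<open>p < q\<close> by auto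
    have "\<not> rad (p + 1)" using rad_outside less.prems * by blast
    then consider t where "arc (p + 1) t" | t where "t < p + 1" "arc t (p + 1)"
      using exit[of "p + 1" "p + 1"] H_ge l_ge by (auto simp: N_def)
    then show ?thesis
    proof cases
      case 1
      then have "t \<le> q" using laminar less.prems * by blast
      then obtain r where "p + 1 \<le> r \<and> r < t \<and> arc r (r + 1)"
        using less.hyps[of t "p + 1"] 1 * arc_less[OF 1] by auto
      then show ?thesis using \<open>t \<le> q\<close> by (intro exI[of _ r]) auto
    next
      case 2
      then have "t = p" using laminar[OF 2(2) less.prems] * by linarith
      then show ?thesis using 2 * by auto
    qed
  qed
qed

text \<open>\<open>H\<close> is the largest length for which arcs start at every point.\<close>

abbreviation "L p \<equiv> arc p (p + H)"

lemma L_eq: "\<lbrakk>L p; L q; p \<le> t; t < p + H; q \<le> t; t < q + H\<rbrakk> \<Longrightarrow> p = q"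
  using nested[of p "p + H" q "q + H" t] by linarith

definition "Ls = {p \<in> {0..<N}. L p}"
definition "Bs = {r \<in> {0..<N}. arc r (r + 1)}"

definition "bd_of p = (SOME r. p \<le> r \<and> r < p + H \<and> arc r (r + 1))"

lemma bd_of: "L p \<Longrightarrow> p \<le> bd_of p \<and> bd_of p < p + H \<and> arc (bd_of p) (bd_of p + 1)"
  unfolding bd_of_def by (rule someI_ex, rule ex_boundary)

lemma arc_mod_bd: "arc (r mod N) (r mod N + 1) \<longleftrightarrow> arc r (r + 1)"
  using arc_period_mult[of r "- (r div N)" "r + 1"]
  by (simp add: minus_div_mult_eq_mod[symmetric] algebra_simps)

lemma L_mod: "L (r mod N) \<longleftrightarrow> L r"
  using arc_period_mult[of r "- (r div N)" "r + H"]
  by (simp add: minus_div_mult_eq_mod[symmetric] algebra_simps)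

lemma L_mod_eq:
  assumes "L p" "L q" "p \<le> s" "s < p + H" "q \<le> t" "t < q + H" "s mod N = t mod N"
  shows "p mod N = q mod N"
proof -
  obtain c where c: "t = s + c * N"
    using assms(7) by (metis mod_eqE mult.commute)
  have "L (p + c * N)"
    using assms(1) arc_period_mult[of p c "p + H"] by (simp add: algebra_simps)
  then have "p + c * N = q"
    by (rule L_eq[where t = t]) (use assms c in auto)
  then show ?thesis by auto
qed

text \<open>Two arcs of length \<open>H\<close> over a common boundary edge are nested, and equal
  lengths make them equal.\<close>

lemma inj_bd: "inj_on (\<lambda>p. bd_of p mod N) Ls"
proof
  fix p q assume "p \<in> Ls" "q \<in> Ls" "bd_of p mod N = bd_of q mod N"
  then have "p mod N = q mod N"
    using L_mod_eq[of p q "bd_of p" "bd_of q"] bd_of by (auto simp: Ls_def)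
  then show "p = q" using \<open>p \<in> Ls\<close> \<open>q \<in> Ls\<close> by (auto simp: Ls_def)
qed

lemma bd_image: "(\<lambda>p. bd_of p mod N) ` Ls \<subseteq> Bs"
  using bd_of arc_mod_bd N_pos by (auto simp: Ls_def Bs_def)

lemma finite_Ls: "finite Ls" and finite_Bs: "finite Bs"
  by (rule finite_subset[of _ "{0..<N}"]; auto simp: Ls_def Bs_def)+

lemma card_Ls_le: "card Ls \<le> card Bs"
  using card_inj_on_le[OF inj_bd bd_image finite_Bs] .

text \<open>Three disjoint arcs of length \<open>H\<close> need
  \<open>3 * H \<le> N = 2 * H + l\<close>. This forces \<open>H = l\<close>, and then the arcs
  close up to a triangle, which \<open>no_triangle\<close> forbids.\<close>

lemma card_Ls_le_2: "card Ls \<le> 2"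
proof (rule ccontr)
  assume "\<not> card Ls \<le> 2"
  then have c3: "card Ls \<ge> 3" by simp
  then have ne: "Ls \<noteq> {}" by auto
  define x where "x = Min Ls"
  define z where "z = Max Ls"
  have "\<not> Ls \<subseteq> {x, z}"
  proof
    assume "Ls \<subseteq> {x, z}"
    then have "card Ls \<le> card {x, z}" by (intro card_mono) auto
    also have "\<dots> \<le> 2" by (simp add: card_insert_if)
    finally show False using c3 by simp
  qed
  then obtain y where y: "y \<in> Ls" "y \<noteq> x" "y \<noteq> z" by blast
  have "x \<in> Ls" "z \<in> Ls" "x \<le> y" "y \<le> z"
    using finite_Ls ne y by (auto simp: x_def z_def)
  with y have L: "L x" "L y" "L z" "x < y" "y < z" "0 \<le> x" "z < N"
    by (auto simp: Ls_def)
  have 1: "x + H \<le> y" using L_eq[OF L(1,2), of y] L by linarith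
  have 2: "y + H \<le> z" using L_eq[OF L(2,3), of z] L by linarith
  have "L (x + N)" using L(1) arc_period[of x "x + H"] by (simp add: algebra_simps)
  then have 3: "z + H \<le> x + N" using L_eq[OF L(3), of "x + N" "x + N"] L by linarith
  have "H \<le> l" using 1 2 3 by (simp add: N_def)
  then have "H = l" using H_ge by simp
  then have "y = x + H" "z = y + H" "x + N = z + H" using 1 2 3 by (auto simp: N_def)
  then show False using no_triangle[of x y z] L by (simp add: add.commute)
qed

lemma bd_surj:
  assumes "card Ls = card Bs"
  shows "(\<lambda>p. bd_of p mod N) ` Ls = Bs"
  using card_subset_eq[OF finite_Bs bd_image] card_image[OF inj_bd] assms by simp

text \<open>Equal cardinalities make the injection \<open>bd_of\<close> onto, so every boundary edge
  is the chosen one of some arc of length \<open>H\<close>.\<close>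

lemma boundary_in_L_if_card:
  assumes card: "card Ls = card Bs" and "arc r (r + 1)"
  shows "\<exists>p. L p \<and> p \<le> r \<and> r < p + H"
proof -
  have "r mod N \<in> Bs" using assms arc_mod_bd N_pos by (auto simp: Bs_def)
  then obtain p where p: "p \<in> Ls" "r mod N = bd_of p mod N"
    using bd_surj[OF card] by auto
  then obtain c where c: "r = bd_of p + c * N"
    by (metis mod_eqE mult.commute)
  have "L p" using p by (simp add: Ls_def)
  then have "L (p + c * N)" using arc_period_mult[of p c "p + H"] by (simp add: algebra_simps)
  then show ?thesis using bd_of[OF \<open>L p\<close>] c by (intro exI[of _ "p + c * N"]) auto
qed

lemma boundary_unique_if_card:
  assumes card: "card Ls = card Bs" and "arc r (r + 1)" "arc s (s + 1)" "L p" "p \<le> r" "r < p + H" "p \<le> s" "s < p + H"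
  shows "r = s"
proof -
  have *: "x mod N = bd_of (p mod N) mod N" if "arc x (x + 1)" "p \<le> x" "x < p + H" for x
  proof -
    have "x mod N \<in> Bs" using that arc_mod_bd N_pos by (auto simp: Bs_def)
    then obtain q where q: "q \<in> Ls" "x mod N = bd_of q mod N" using bd_surj[OF card] by auto
    have "L q" using q by (simp add: Ls_def)
    have "p mod N = q mod N"
      by (rule L_mod_eq[of p q x "bd_of q"]) (use \<open>L q\<close> assms that q bd_of in auto)
    then show ?thesis using q by (auto simp: Ls_def)
  qed
  have "r mod N = s mod N" using * assms by metis
  then obtain c where c: "s = r + c * N" by (metis mod_eqE mult.commute)
  \<comment> \<open>Both edges lie in a window of length \<open>H < N\<close>, so congruence modulo
    \<open>N\<close> is equality.\<close>
  then show ?thesis using multiple_N_cases[of c] assms H_ge l_ge N_def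
    by (cases "c = 0") (simp, linarith)
qed

end

section \<open>Trees with equally many boundary edges and arcs of length \<open>H\<close>\<close>

locale tight_wheel_tree = wheel_tree +
  assumes boundary_in_L: "arc r (r + 1) \<Longrightarrow> \<exists>p. L p \<and> p \<le> r \<and> r < p + H"
    and boundary_unique: "\<lbrakk>arc r (r + 1); arc s (s + 1); L p; p \<le> r; r < p + H; p \<le> s; s < p + H\<rbrakk> \<Longrightarrow> r = s"
begin

text \<open>A boundary edge below the arc also lies below an arc of length \<open>H\<close>, and
  arcs over a common edge are nested.\<close>

lemma nested_L:
  assumes "arc r s"
  obtains p where "L p" "p \<le> r \<and> s \<le> p + H \<or> r \<le> p \<and> p + H \<le> s"
proof -
  obtain t where t: "r \<le> t" "t < s" "arc t (t + 1)" using ex_boundary[OF assms] by auto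
  then obtain p where p: "L p" "p \<le> t" "t < p + H" using boundary_in_L by blast
  show thesis using that p nested[OF p(1) assms, of t] t by blast
qed

text \<open>Each boundary edge below lies under an arc of length \<open>H\<close> inside the given
  one. Two different such arcs are disjoint and would need \<open>2 * H \<le> q - p < H + l\<close>,
  against \<open>l \<le> H\<close>.\<close>

lemma boundary_unique_long:
  assumes "arc p q" "q - p \<ge> H" "arc r (r + 1)" "arc s (s + 1)" "p \<le> r" "r < q" "p \<le> s" "s < q"
  shows "r = s"
proof -
  have *: "\<exists>y. L y \<and> p \<le> y \<and> y + H \<le> q \<and> y \<le> x \<and> x < y + H"
    if x: "arc x (x + 1)" "p \<le> x" "x < q" for x
  proof -
    obtain y where y: "L y" "y \<le> x" "x < y + H" using boundary_in_L x by blast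
    then have "p \<le> y \<and> y + H \<le> q"
      using nested[OF y(1) assms(1), of x] x assms(2) by linarith
    then show ?thesis using y by blast
  qed
  obtain y z where y: "L y" "p \<le> y" "y + H \<le> q" "y \<le> r" "r < y + H"
    and z: "L z" "p \<le> z" "z + H \<le> q" "z \<le> s" "s < z + H"
    using *[of r] *[of s] assms by blast
  have "q < p + H + l" using arc_length[OF assms(1)] by simp
  then have "y = z"
    using L_eq[OF y(1) z(1), of "max y z"] y z H_ge by linarith
  then show ?thesis using boundary_unique y z assms by blast
qed

text \<open>An arc over a single boundary edge is the outermost one of a zigzag, so it can be peeled.\<close>

lemma shorten:
  assumes pq: "arc p q" "q - p > H"
  shows "arc (p + 1) q \<or> arc p (q - 1)"
proof (rule ccontr)
  assume neg: "\<not> (arc (p + 1) q \<or> arc p (q - 1))"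
  have len: "p + 3 < q" using pq H_ge l_ge by linarith
  have lt: "q < p + H + l" using arc_length[OF pq(1)] by simp
  have uni: "r = s" if "arc r (r + 1)" "arc s (s + 1)" "p \<le> r" "r < q" "p \<le> s" "s < q" for r s
    using boundary_unique_long pq that by auto
  \<comment> \<open>All arcs below the arc from \<open>p\<close> to \<open>q\<close> cover its
    single boundary edge, so any two of them overlap.\<close>
  have meet: "\<exists>x. a \<le> x \<and> x < b \<and> c \<le> x \<and> x < d"
    if m: "arc a b" "arc c d" "p \<le> a" "b \<le> q" "p \<le> c" "d \<le> q" for a b c d
  proof -
    obtain x y where "a \<le> x" "x < b" "arc x (x + 1)" "c \<le> y" "y < d" "arc y (y + 1)"
      using ex_boundary[OF m(1)] ex_boundary[OF m(2)] by blast
    then show ?thesis using uni[of x y] m by (intro exI[of _ x]) auto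
  qed
  have no1: "\<not> rad (p + 1)" "\<not> rad (q - 1)" using rad_outside[OF pq(1)] len by auto
  have inside_up: "t \<le> q" if "arc x t" "p < x" "x < q" for x t
    using laminar[OF pq(1) that(1)] that by auto
  have inside_down: "p \<le> t" if "arc t x" "p < x" "x < q" for x t
    using laminar[OF that(1) pq(1)] that by linarith
  have e1: "(\<exists>t. arc (p + 1) t) \<or> arc p (p + 1)"
    using exit[of "p + 1" "p + 1"] no1 len inside_down[of _ "p + 1"] H_ge l_ge
    by (force simp: N_def)
  have e2: "(\<exists>t. arc t (q - 1)) \<or> arc (q - 1) q"
  proof -
    have "(\<exists>t. q - 1 < t \<and> arc (q - 1) t) \<or> (\<exists>t. arc t (q - 1))"
      using exit[of "q - 1" "q - 1"] no1 len N_pos by fastforce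
    moreover have "t = q" if "q - 1 < t" "arc (q - 1) t" for t
      using inside_up[OF that(2)] that(1) len by linarith
    ultimately show ?thesis by blast
  qed
  \<comment> \<open>A boundary edge at \<open>p\<close> would be the only one, so the arc ending at
    \<open>q - 1\<close> would have to reach back to \<open>p\<close>, against
    \<open>neg\<close>.\<close>
  have np: "\<not> arc p (p + 1)"
  proof
    assume a: "arc p (p + 1)"
    have "\<not> arc (q - 1) q" using meet[OF a, of "q - 1" q] len by auto
    then obtain t where t: "arc t (q - 1)" using e2 by blast
    then have "p \<le> t" using inside_down len by auto
    then have "t = p" using meet[OF a t] len by auto
    then show False using t neg by simp
  qed
  have nq: "\<not> arc (q - 1) q"
  proof
    assume a: "arc (q - 1) q"
    obtain t where t: "arc (p + 1) t" using np e1 by blast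
    then have "t \<le> q" using inside_up len by auto
    then have "t = q" using meet[OF a t] len by auto
    then show False using t neg by simp
  qed
  obtain t s where t: "arc (p + 1) t" and s: "arc s (q - 1)" using e1 e2 np nq by blast
  have tq: "t < q" using inside_up[OF t] len t neg by (cases "t = q") auto
  have sp: "p < s" using inside_down[OF s] len s neg by (cases "s = p") auto
  obtain x where "p + 1 \<le> x" "x < t" "s \<le> x" "x < q - 1"
    using meet[OF t s] tq sp by auto
  then have "p + 1 \<le> s \<and> q - 1 \<le> t \<or> s \<le> p + 1 \<and> t \<le> q - 1" using nested[OF t s] by blast
  \<comment> \<open>Neither arc reaches \<open>p\<close> or \<open>q\<close>, so nestedness makes
    them one arc. Only its two ends could still be joined to \<open>p\<close> or \<open>q\<close>,
    and \<open>neg\<close>, \<open>np\<close> and \<open>nq\<close> rule this out.\<close>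
  then have mid: "arc (p + 1) (q - 1)"
  proof
    assume "p + 1 \<le> s \<and> q - 1 \<le> t"
    then have "t = q - 1" using tq by linarith
    then show ?thesis using t by simp
  next
    assume "s \<le> p + 1 \<and> t \<le> q - 1"
    then have "s = p + 1" using sp by linarith
    then show ?thesis using s by simp
  qed
  obtain r where r: "p + 1 \<le> r" "r \<le> q - 1"
    "rad r \<or> (\<exists>t. q - 1 < t \<and> arc r t) \<or> (\<exists>t. t < p + 1 \<and> arc t r)"
    using exit[of "p + 1" "q - 1"] len lt H_ge l_ge by (auto simp: N_def)
  consider "rad r" | t where "q - 1 < t" "arc r t" | t where "t < p + 1" "arc t r"
    using r(3) by blast
  then show False
  proof cases
    case 1 then show False using rad_outside[OF pq(1)] r by auto
  next
    case 2
    then have "t = q" using inside_up[of r t] r by auto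
    then have "r \<noteq> p + 1" using 2 neg by auto
    moreover have "r \<noteq> q - 1" using 2 \<open>t = q\<close> nq by auto
    ultimately show False using laminar[OF mid 2(2)] r 2 by auto
  next
    case 3
    then have "t = p" using inside_down[of t r] r by auto
    then have "r \<noteq> q - 1" using 3 neg by auto
    moreover have "r \<noteq> p + 1" using 3 \<open>t = p\<close> np by auto
    ultimately show False using laminar[OF 3(2) mid] r 3 by auto
  qed
qed

text \<open>Peeling off one point at a time passes through every length down to
  \<open>H + 1\<close>, the length used for the pigeonhole argument.\<close>

lemma ex_length_Suc_H:
  assumes "arc p q" "q - p > H"
  shows "\<exists>r. p \<le> r \<and> r + H + 1 \<le> q \<and> arc r (r + H + 1)"
  using assms
proof (induction "nat (q - p)" arbitrary: p q rule: less_induct)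
  case less
  show ?case
  proof (cases "q - p = H + 1")
    case True
    then have "q = p + H + 1" by linarith
    then show ?thesis using less.prems by (intro exI[of _ p]) simp
  next
    case False
    then have *: "q - p > H + 1" using less.prems by linarith
    then have **: "nat (q - (p + 1)) < nat (q - p)" "nat (q - 1 - p) < nat (q - p)"
      using H_ge l_ge by auto
    from shorten[OF less.prems] show ?thesis
    proof
      assume "arc (p + 1) q"
      then obtain r where "p + 1 \<le> r \<and> r + H + 1 \<le> q \<and> arc r (r + H + 1)"
        using less.hyps[OF **(1)] * by fastforce
      then show ?thesis by (intro exI[of _ r]) auto
    next
      assume "arc p (q - 1)"
      then obtain r where "p \<le> r \<and> r + H + 1 \<le> q - 1 \<and> arc r (r + H + 1)"
        using less.hyps[OF **(2)] * by fastforce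
      then show ?thesis by (intro exI[of _ r]) auto
    qed
  qed
qed

text \<open>The arc of length \<open>H\<close> already meets \<open>h + 1\<close> groups, the most
  an arc may meet, so an arc around it starts and ends in the same two groups.\<close>

lemma around:
  assumes "arc r s" "L p" "r \<le> p" "p + H \<le> s"
  shows "p div l * l \<le> r" "s < p div l * l + H + l"
proof -
  have 1: "s div l \<le> r div l + h" using arc_short assms(1) .
  have 2: "p div l + h \<le> s div l"
    using zdiv_mono1[OF assms(4), of l] l_ge by simp
  have 3: "r div l \<le> p div l"
    using zdiv_mono1[OF assms(3), of l] l_ge by simp
  show "p div l * l \<le> r" using 1 2 le_div_iff[of "p div l" r] by linarith
  have "s div l \<le> p div l + h" using 1 3 by linarith
  then show "s < p div l * l + H + l" using div_le_iff[of s "p div l + h"] by (simp add: H_def algebra_simps)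
qed

text \<open>\<open>R\<close> represents the arcs of length \<open>H\<close> modulo \<open>N\<close>,
  and the shift \<open>x\<close> moves to the representative. The disjunction on \<open>x\<close> is
  what linear arithmetic needs to know about a multiple of \<open>N\<close>.\<close>

lemma shape:
  assumes "arc r s" and R: "\<And>q. L q \<Longrightarrow> \<exists>p\<in>R. N dvd q - p"
  shows "\<exists>p\<in>R. \<exists>x. (x = 0 \<or> x \<ge> N \<or> x \<le> - N) \<and> arc (r + x) (s + x) \<and>
    (p \<le> r + x \<and> s + x \<le> p + H \<or>
     p div l * l \<le> r + x \<and> r + x \<le> p \<and> p + H \<le> s + x \<and> s + x < p div l * l + H + l)"
proof -
  obtain q where q: "L q" "q \<le> r \<and> s \<le> q + H \<or> r \<le> q \<and> q + H \<le> s"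
    using nested_L[OF assms(1)] .
  obtain p where p: "p \<in> R" "N dvd q - p" using R q by blast
  then obtain d where d: "q - p = N * d" by (auto elim: dvdE)
  define x where "x = (- d) * N"
  have qx: "p = q + x" using d by (simp add: x_def algebra_simps)
  have "x = 0 \<or> x \<ge> N \<or> x \<le> - N" using multiple_N_cases[of "-d"] by (auto simp: x_def)
  moreover have arc: "arc (r + x) (s + x)"
    unfolding x_def using arc_period_mult assms(1) by blast
  moreover have "L p"
    using q(1) arc_period_mult[of q "-d" "q + H"] by (simp add: qx x_def algebra_simps)
  moreover have "p \<le> r + x \<and> s + x \<le> p + H \<or> r + x \<le> p \<and> p + H \<le> s + x"
    using q(2) qx by auto
  ultimately show ?thesis using around[OF arc] p(1) by (intro bexI[of _ p] exI[of _ x]) auto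
qed

text \<open>All arcs stay within the groups \<open>0\<close> to \<open>h\<close>, so points of the
  other groups have only their radial edge. If neither \<open>0\<close> nor \<open>H + l - 1\<close>
  were radial, laminarity would force the arc joining them, and everything below it would be cut off
  from the centre.\<close>

lemma single_L_radials:
  assumes a: "L a" "0 \<le> a" "a < l" and only: "\<And>p. L p \<Longrightarrow> N dvd p - a"
  shows "\<lbrakk>H + l \<le> r; r < N\<rbrakk> \<Longrightarrow> rad r" and "rad 0 \<or> rad (H + l - 1)"
proof -
  have a0: "a div l = 0" using a by simp
  have sh: "\<exists>x. (x = 0 \<or> x \<ge> N \<or> x \<le> - N) \<and>
    (a \<le> r + x \<and> s + x \<le> a + H \<or>
     0 \<le> r + x \<and> r + x \<le> a \<and> a + H \<le> s + x \<and> s + x < H + l)" if "arc r s" for r s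
    using shape[OF that, of "{a}"] only a0 by auto
  show "rad r" if "H + l \<le> r" "r < N" for r
  proof (rule ccontr)
    assume "\<not> rad r"
    then consider t where "r < t" "t < r + N" "arc r t" | t where "t < r" "r < t + N" "arc t r"
      using exit1[of r] by blast
    then show False
    proof cases
      case 1 then show False using sh[OF 1(3)] that a H_ge N_def by (elim exE conjE disjE) linarith+
    next
      case 2 then show False using sh[OF 2(3)] that a H_ge N_def by (elim exE conjE disjE) linarith+
    qed
  qed
  show "rad 0 \<or> rad (H + l - 1)"
  proof (rule ccontr)
    assume neg: "\<not> (rad 0 \<or> rad (H + l - 1))"
    have up: "\<exists>t. arc 0 t \<and> a + H \<le> t \<and> t < H + l"
    proof -
      from neg consider t where "0 < t" "t < N" "arc 0 t" | t where "t < 0" "0 < t + N" "arc t 0"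
        using exit1[of 0] by auto
      then show ?thesis
      proof cases
        case 1
        then have "a = 0 \<or> a + H \<le> t \<and> t < H + l"
          using sh[OF 1(3)] a H_ge N_def by (elim exE conjE disjE) linarith+
        then show ?thesis using a(1) 1 l_ge by (metis add.commute add_0 order_refl
            add_less_cancel_left order_less_le_trans zero_less_numeral)
      next
        case 2
        then show ?thesis using sh[OF 2(3)] a H_ge N_def by (elim exE conjE disjE) linarith+
      qed
    qed
    have down: "\<exists>s. arc s (H + l - 1) \<and> 0 \<le> s \<and> s \<le> a"
    proof -
      let ?w = "H + l - 1"
      from neg consider t where "?w < t" "t < ?w + N" "arc ?w t" | t where "t < ?w" "?w < t + N" "arc t ?w"
        using exit1[of ?w] by blast
      then show ?thesis
      proof cases
        case 1
        then show ?thesis using sh[OF 1(3)] a H_ge N_def by (elim exE conjE disjE) linarith+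
      next
        case 2
        then have "a = l - 1 \<or> 0 \<le> t \<and> t \<le> a"
          using sh[OF 2(3)] a H_ge N_def by (elim exE conjE disjE) linarith+
        then show ?thesis
        proof
          assume "a = l - 1"
          then have "a + H = ?w" by simp
          then have "arc a ?w" using a(1) by metis
          then show ?thesis using a by auto
        qed (use 2 in auto)
      qed
    qed
    obtain t s where t: "arc 0 t" "a + H \<le> t" "t < H + l" and s: "arc s (H + l - 1)" "0 \<le> s" "s \<le> a"
      using up down by blast
    have out: "arc 0 (H + l - 1)"
    proof (cases "s = 0")
      case False
      then have "H + l - 1 \<le> t" using laminar[OF t(1) s(1)] s t H_ge l_ge by linarith
      then have "t = H + l - 1" using t by linarith
      then show ?thesis using t by simp
    qed (use s in simp)
    obtain r where r: "0 \<le> r" "r \<le> H + l - 1" "rad r \<or> (\<exists>t. H + l - 1 < t \<and> t < N \<and> arc r t) \<or>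
        (\<exists>t<0. H + l - 1 < t + N \<and> arc t r)"
      using exit[of 0 "H + l - 1"] H_ge l_ge by (auto simp: N_def)
    from r(3) show False
    proof (elim disjE exE conjE)
      assume "rad r"
      then have "r \<noteq> 0" "r \<noteq> H + l - 1" using neg by auto
      then show False using rad_outside[OF out] \<open>rad r\<close> r by auto
    next
      fix t assume "H + l - 1 < t" "t < N" "arc r t"
      then show False using sh[of r t] r a H_ge N_def by (elim exE conjE disjE) linarith+
    next
      fix t assume "t < 0" "H + l - 1 < t + N" "arc t r"
      then show False using sh[of t r] r a H_ge N_def by (elim exE conjE disjE) linarith+
    qed
  qed
qed

end

section \<open>Trees with two arcs of length \<open>H\<close>\<close>

locale two_L_tree = tight_wheel_tree +
  fixes p q :: int
  assumes Lp: "L p" and Lq: "L q" and pq: "p + H \<le> q" and q_div: "q div l = p div l + h"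
    and only: "L r \<Longrightarrow> N dvd r - p \<or> N dvd r - q"
begin

text \<open>The arcs nested with the one at \<open>p\<close> stay, up to period, between
  \<open>u\<close> and \<open>u + H + l - 1\<close>, those nested with the one at \<open>q\<close>
  between \<open>u + H\<close> and \<open>u + N - 1\<close>. The window from \<open>u\<close> to
  \<open>u + N - 1\<close> thus has the group of \<open>q\<close> as its middle group.\<close>

definition "u = p div l * l"

lemma u_le: "u \<le> p" "p < u + l"
  using div_eq_iff[of p "p div l"] by (auto simp: u_def)

lemma q_less: "q < u + H + l" "u + H \<le> q"
  using div_eq_iff[of q "p div l + h"] q_div by (auto simp: u_def H_def algebra_simps)

lemma two_shape:
  assumes "arc r s"
  shows "\<exists>x. (x = 0 \<or> x \<ge> N \<or> x \<le> - N) \<and> arc (r + x) (s + x) \<and>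
    (p \<le> r + x \<and> s + x \<le> p + H \<or>
     u \<le> r + x \<and> r + x \<le> p \<and> p + H \<le> s + x \<and> s + x < u + H + l \<or>
     q \<le> r + x \<and> s + x \<le> q + H \<or>
     u + H \<le> r + x \<and> r + x \<le> q \<and> q + H \<le> s + x \<and> s + x < u + N)"
proof -
  have "q div l * l = u + H" using q_div by (simp add: u_def H_def algebra_simps)
  moreover have "\<exists>y\<in>{p, q}. N dvd z - y" if "L z" for z using only[OF that] by auto
  ultimately show ?thesis
    using shape[OF assms, of "{p, q}"] by (simp add: u_def N_def) (smt (verit, best))
qed

lemma first_group: "\<not> rad u \<Longrightarrow> \<exists>t. arc u t \<and> p + H \<le> t \<and> t < u + H + l"
proof -
  assume "\<not> rad u"
  then consider t where "u < t" "t < u + N" "arc u t" | t where "t < u" "u < t + N" "arc t u"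
    using exit1[of u] by blast
  then show ?thesis
  proof cases
    case 1
    then have "p = u \<or> p + H \<le> t \<and> t < u + H + l"
      using two_shape[OF 1(3)] u_le q_less pq H_ge N_def by (elim exE conjE disjE) linarith+
    then show ?thesis
    proof
      assume "p = u"
      then show ?thesis using Lp l_ge by (intro exI[of _ "u + H"]) auto
    qed (use 1 in blast)
  next
    case 2
    then show ?thesis
      using two_shape[OF 2(3)] u_le q_less pq H_ge N_def by (elim exE conjE disjE) linarith+
  qed
qed

lemma last_group: "\<not> rad (u + N - 1) \<Longrightarrow> \<exists>s. arc s (u + N - 1) \<and> u + H \<le> s \<and> s \<le> q"
proof -
  let ?w = "u + N - 1"
  assume "\<not> rad ?w"
  then consider t where "?w < t" "t < ?w + N" "arc ?w t" | t where "t < ?w" "?w < t + N" "arc t ?w"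
    using exit1[of ?w] by blast
  then show ?thesis
  proof cases
    case 1
    then show ?thesis
      using two_shape[OF 1(3)] u_le q_less pq H_ge N_def by (elim exE conjE disjE) linarith+
  next
    case 2
    then have "q + H = ?w \<or> u + H \<le> t \<and> t \<le> q"
      using two_shape[OF 2(3)] u_le q_less pq H_ge N_def by (elim exE conjE disjE) linarith+
    then show ?thesis
    proof
      assume "q + H = ?w"
      then show ?thesis using Lq q_less by (intro exI[of _ q]) auto
    qed (use 2 in blast)
  qed
qed

text \<open>If neither end of the window is radial, an arc runs from each end into the middle group,
  and radial edges can only end between these two arcs.\<close>

lemma ex_end_or_middle_radial:
  "\<exists>r. rad r \<and> (r mod l = 0 \<or> r mod l = l - 1 \<or> r div l = p div l + h)"
proof (cases "rad u \<or> rad (u + N - 1)")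
  case True
  have "u mod l = 0" by (simp add: u_def)
  moreover have "(u + N - 1) mod l = l - 1"
  proof -
    have "u + N - 1 = (l - 1) + l * (p div l + 2 * h)"
      by (simp add: u_def N_def H_def algebra_simps)
    then show ?thesis by (simp only: mod_last)
  qed
  ultimately show ?thesis using True by metis
next
  case False
  then obtain t s where t: "arc u t" "p + H \<le> t" "t < u + H + l"
    and s: "arc s (u + N - 1)" "u + H \<le> s" "s \<le> q"
    using first_group last_group by blast
  obtain r where r: "u \<le> r" "r < u + N" "rad r" using ex_rad by blast
  then have "r \<noteq> u" "r \<noteq> u + N - 1" using False by auto
  then have "t \<le> r" "r \<le> s" using rad_outside[OF t(1)] rad_outside[OF s(1)] r by force+
  then have "r div l = p div l + h"
    using t s u_le q_less div_eq_iff[of r "p div l + h"]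
    by (simp add: H_def u_def algebra_simps)
  then show ?thesis using r by blast
qed

text \<open>Otherwise maximality gives \<open>p = u\<close>, and connectedness of the points from
  \<open>u\<close> to \<open>u + H\<close> to the rest gives an arc from \<open>u + H\<close> to
  \<open>u + N - 1\<close>. These two arcs leave only \<open>u\<close>, \<open>u + H\<close> and
  \<open>u + N - 1\<close> for radial edges, and all three are ends of groups.\<close>

lemma ex_end_radial_if_top:
  assumes top: "\<And>r s. \<lbrakk>arc r s; r \<le> p; p + H \<le> s\<rbrakk> \<Longrightarrow> r = p \<and> s = p + H"
  shows "\<exists>r. rad r \<and> (r mod l = 0 \<or> r mod l = l - 1)"
proof -
  have ends: "r mod l = 0 \<or> r mod l = l - 1" if "r = u \<or> r = u + H \<or> r = u + N - 1" for r
  proof -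
    have "u + N - 1 = (l - 1) + l * (p div l + 2 * h)"
      by (simp add: u_def N_def H_def algebra_simps)
    then have "(u + N - 1) mod l = l - 1" by (simp only: mod_last)
    moreover have "(u + H) mod l = 0" by (simp add: u_def H_def)
    ultimately show ?thesis using that by (auto simp: u_def)
  qed
  have "\<exists>r. rad r \<and> (r = u \<or> r = u + H \<or> r = u + N - 1)"
  proof (rule ccontr)
    assume neg: "\<not> ?thesis"
    obtain t s where t: "arc u t" "p + H \<le> t" "t < u + H + l"
      and s: "arc s (u + N - 1)" "u + H \<le> s" "s \<le> q"
      using first_group last_group neg by blast
    have p: "p = u" "t = u + H" using top[OF t(1)] t u_le by auto
    have uH: "arc u (u + H)" using Lp p by simp
    show False
    proof (cases "s = u + H")
      case True
      obtain r where r: "u \<le> r" "r < u + N" "rad r" using ex_rad by blast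
      then have "r \<noteq> u" "r \<noteq> u + H" "r \<noteq> u + N - 1" using neg by auto
      then show False using rad_outside[OF uH] rad_outside[OF s(1)] r True by force
    next
      case False
      obtain r where r: "u \<le> r" "r \<le> u + H" "rad r \<or> (\<exists>t. u + H < t \<and> t < u + N \<and> arc r t) \<or>
          (\<exists>t<u. u + H < t + N \<and> arc t r)"
        using exit[of u "u + H"] H_ge l_ge by (auto simp: N_def)
      from r(3) show False
      proof (elim disjE exE conjE)
        assume "rad r"
        then have "r \<noteq> u" "r \<noteq> u + H" using neg by auto
        then show False using rad_outside[OF uH] \<open>rad r\<close> r by auto
      next
        fix t assume t: "u + H < t" "t < u + N" "arc r t"
        then have "r = u + H"
          using laminar[OF uH t(3)] top[OF t(3)] r p by force
        obtain x where x: "x = 0 \<or> x \<ge> N \<or> x \<le> - N" "arc (r + x) (t + x)"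
          "p \<le> r + x \<and> t + x \<le> p + H \<or>
           u \<le> r + x \<and> r + x \<le> p \<and> p + H \<le> t + x \<and> t + x < u + H + l \<or>
           q \<le> r + x \<and> t + x \<le> q + H \<or>
           u + H \<le> r + x \<and> r + x \<le> q \<and> q + H \<le> t + x \<and> t + x < u + N"
          using two_shape[OF t(3)] by blast
        have "q < t" using x t \<open>r = u + H\<close> p u_le q_less pq H_ge N_def l_ge
          by (elim conjE disjE) linarith+
        \<comment> \<open>The arc leaving \<open>u + H\<close> reaches beyond \<open>q\<close>,
          hence into the arc from \<open>s\<close>, and laminarity pushes its end to the end of the
          window.\<close>
        then have "u + N - 1 \<le> t"
          using laminar[OF t(3) s(1)] s False \<open>r = u + H\<close> by linarith
        then have "t = u + N - 1" using t by simp
        then have "arc (u + H) (u + N - 1)" using t \<open>r = u + H\<close> by simp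
        obtain r where r: "u \<le> r" "r < u + N" "rad r" using ex_rad by blast
        then have "r \<noteq> u" "r \<noteq> u + H" "r \<noteq> u + N - 1" using neg by auto
        then show False using rad_outside[OF uH] rad_outside[OF \<open>arc (u + H) (u + N - 1)\<close>] r by force
      next
        fix t assume t: "t < u" "u + H < t + N" "arc t r"
        then show False
          using two_shape[OF t(3)] r p u_le q_less pq H_ge N_def l_ge
          by (elim exE conjE disjE) linarith+
      qed
    qed
  qed
  then show ?thesis using ends by blast
qed

end

section \<open>Reflection of the cyclic order\<close>

context tight_wheel_tree
begin

text \<open>The map from \<open>r\<close> to \<open>l - 1 - r\<close> sends group \<open>i\<close>
  to group \<open>- i\<close> and reverses each group; a bare change of sign would not respect the
  groups.\<close>

lemma tight_reflect:
  "tight_wheel_tree h l N H (\<lambda>r s. arc (l - 1 - s) (l - 1 - r)) (\<lambda>r. rad (l - 1 - r))"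
proof -
  have div: "(l - 1 - r) div l = - (r div l)" for r
    using div_eq_iff[of r "r div l"] div_eq_iff[of "l - 1 - r" "- (r div l)"] by auto
  show ?thesis
  proof unfold_locales
    fix r s assume "arc (l - 1 - s) (l - 1 - r)"
    then show "r < s" "s div l \<le> r div l + h" using arc_less arc_short div by force+
  next
    fix r s show "arc (l - 1 - (s + N)) (l - 1 - (r + N)) = arc (l - 1 - s) (l - 1 - r)"
      using arc_period_mult[of "l - 1 - s" "-1" "l - 1 - r"] by (simp add: algebra_simps)
  next
    fix r show "rad (l - 1 - (r + N)) = rad (l - 1 - r)"
      using rad_period_mult[of "l - 1 - r" "-1"] by (simp add: algebra_simps)
  next
    fix p q r s
    assume "arc (l - 1 - q) (l - 1 - p)" "arc (l - 1 - s) (l - 1 - r)" "p < r" "r < q"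
    then show "s \<le> q" using laminar[of "l - 1 - s" "l - 1 - r" "l - 1 - q" "l - 1 - p"] by linarith
  next
    fix p q r
    assume "arc (l - 1 - q) (l - 1 - p)" "p < r" "r < q"
    then show "\<not> rad (l - 1 - r)" using rad_outside by auto
  next
    fix x y :: int assume "x \<le> y" "y < x + N"
    then obtain r where r: "l - 1 - y \<le> r" "r \<le> l - 1 - x"
      "rad r \<or> (\<exists>t. l - 1 - x < t \<and> t < l - 1 - y + N \<and> arc r t) \<or>
       (\<exists>t. t < l - 1 - y \<and> l - 1 - x < t + N \<and> arc t r)"
      using exit[of "l - 1 - y" "l - 1 - x"] by auto
    define r' where "r' = l - 1 - r"
    have r': "r = l - 1 - r'" "x \<le> r'" "r' \<le> y" using r by (auto simp: r'_def)
    from r(3) have "rad r \<or> (\<exists>t. y < t \<and> t < x + N \<and> arc (l - 1 - t) r) \<or>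
       (\<exists>t. t < x \<and> y < t + N \<and> arc r (l - 1 - t))"
    proof (elim disjE exE conjE)
      fix t assume "l - 1 - x < t" "t < l - 1 - y + N" "arc r t"
      then have "l - 1 - t < x \<and> y < (l - 1 - t) + N \<and> arc r (l - 1 - (l - 1 - t))" by simp
      then show ?thesis by blast
    next
      fix t assume "t < l - 1 - y" "l - 1 - x < t + N" "arc t r"
      then have "y < l - 1 - t \<and> l - 1 - t < x + N \<and> arc (l - 1 - (l - 1 - t)) r" by simp
      then show ?thesis by blast
    qed simp
    then show "\<exists>r. x \<le> r \<and> r \<le> y \<and>
      (rad (l - 1 - r) \<or> (\<exists>t>y. t < x + N \<and> arc (l - 1 - t) (l - 1 - r)) \<or>
       (\<exists>t<x. y < t + N \<and> arc (l - 1 - r) (l - 1 - t)))"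
      using r' by blast
  next
    fix p q r assume "arc (l - 1 - q) (l - 1 - p)" "arc (l - 1 - r) (l - 1 - q)"
    then show "\<not> arc (l - 1 - (p + N)) (l - 1 - r)"
      using no_triangle[of "l - 1 - r" "l - 1 - q" "l - 1 - p"]
        arc_period_mult[of "l - 1 - (p + N)" 1 "l - 1 - r"] by (auto simp: algebra_simps)
  next
    fix r assume "arc (l - 1 - (r + 1)) (l - 1 - r)"
    then have "arc (l - 2 - r) (l - 2 - r + 1)" by (simp add: algebra_simps)
    then obtain p where p: "L p" "p \<le> l - 2 - r" "l - 2 - r < p + H" using boundary_in_L by blast
    then show "\<exists>p. arc (l - 1 - (p + H)) (l - 1 - p) \<and> p \<le> r \<and> r < p + H"
      by (intro exI[of _ "l - 1 - p - H"]) (auto simp: algebra_simps)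
  next
    fix r s p
    assume "arc (l - 1 - (r + 1)) (l - 1 - r)" "arc (l - 1 - (s + 1)) (l - 1 - s)"
      "arc (l - 1 - (p + H)) (l - 1 - p)" and le: "p \<le> r" "r < p + H" "p \<le> s" "s < p + H"
    then have "arc (l - 2 - r) (l - 2 - r + 1)" "arc (l - 2 - s) (l - 2 - s + 1)" "L (l - 1 - p - H)"
      by (simp_all add: algebra_simps)
    from boundary_unique[OF this] le show "r = s" by auto
  qed
qed

end

context two_L_tree
begin

text \<open>The two arcs change roles, and each reflected arc starts at the image of the old right
  end. The middle group goes to the middle group.\<close>

lemma two_L_reflect:
  "two_L_tree h l N H (\<lambda>r s. arc (l - 1 - s) (l - 1 - r)) (\<lambda>r. rad (l - 1 - r))
    (l - 1 - q - H) (l - 1 - p - H)"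
proof -
  interpret R: tight_wheel_tree h l N H "\<lambda>r s. arc (l - 1 - s) (l - 1 - r)" "\<lambda>r. rad (l - 1 - r)"
    by (rule tight_reflect)
  have div: "(l - 1 - r) div l = - (r div l)" for r
    using div_eq_iff[of r "r div l"] div_eq_iff[of "l - 1 - r" "- (r div l)"] by auto
  show ?thesis
  proof unfold_locales
    show "arc (l - 1 - (l - 1 - q - H + H)) (l - 1 - (l - 1 - q - H))"
      "arc (l - 1 - (l - 1 - p - H + H)) (l - 1 - (l - 1 - p - H))"
      using Lp Lq by simp_all
    show "l - 1 - q - H + H \<le> l - 1 - p - H" using pq by simp
    show "(l - 1 - p - H) div l = (l - 1 - q - H) div l + h"
    proof -
      have e: "l - 1 - p - H = l - 1 - (p + H)" "l - 1 - q - H = l - 1 - (q + H)" by simp_all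
      show ?thesis unfolding e div div_add_H q_div by simp
    qed
  next
    fix r assume "arc (l - 1 - (r + H)) (l - 1 - r)"
    then have "L (l - 1 - r - H)" by (simp add: algebra_simps)
    from only[OF this] show "N dvd r - (l - 1 - q - H) \<or> N dvd r - (l - 1 - p - H)"
    proof
      assume "N dvd l - 1 - r - H - p"
      moreover have "r - (l - 1 - p - H) = - (l - 1 - r - H - p)" by simp
      ultimately show ?thesis by (metis dvd_minus_iff)
    next
      assume "N dvd l - 1 - r - H - q"
      moreover have "r - (l - 1 - q - H) = - (l - 1 - r - H - q)" by simp
      ultimately show ?thesis by (metis dvd_minus_iff)
    qed
  qed
qed

lemma ex_end_radial_if_top':
  assumes top: "\<And>r s. \<lbrakk>arc r s; r \<le> q; q + H \<le> s\<rbrakk> \<Longrightarrow> r = q \<and> s = q + H"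
  shows "\<exists>r. rad r \<and> (r mod l = 0 \<or> r mod l = l - 1)"
proof -
  interpret R: two_L_tree h l N H "\<lambda>r s. arc (l - 1 - s) (l - 1 - r)" "\<lambda>r. rad (l - 1 - r)"
    "l - 1 - q - H" "l - 1 - p - H"
    by (rule two_L_reflect)
  have "\<exists>r. rad (l - 1 - r) \<and> (r mod l = 0 \<or> r mod l = l - 1)"
  proof (rule R.ex_end_radial_if_top)
    fix r s assume "arc (l - 1 - s) (l - 1 - r)" "r \<le> l - 1 - q - H" "l - 1 - q - H + H \<le> s"
    then show "r = l - 1 - q - H \<and> s = l - 1 - q - H + H"
      using top[of "l - 1 - s" "l - 1 - r"] by linarith
  qed
  then show ?thesis
  proof (elim exE conjE)
    fix r assume rad: "rad (l - 1 - r)" and r: "r mod l = 0 \<or> r mod l = l - 1"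
    have "l - 1 - r = l - 1 - r mod l + l * (- (r div l))"
      using mult_div_mod_eq[of l r] by (simp only: mult_minus_right)
    then have "(l - 1 - r) mod l = (l - 1 - r mod l) mod l"
      by (simp only: mod_mult_self2)
    also have "\<dots> = l - 1 - r mod l"
      using r l_ge by (intro mod_pos_pos_trivial) auto
    finally have "(l - 1 - r) mod l = 0 \<or> (l - 1 - r) mod l = l - 1" using r by auto
    then show ?thesis using rad by (intro exI[of _ "l - 1 - r"] conjI)
  qed
qed

end

context wheel_tree
begin

lemma tight_if_card: "card Ls = card Bs \<Longrightarrow> tight_wheel_tree h l N H arc rad"
  by unfold_locales (use boundary_in_L_if_card boundary_unique_if_card in blast)+

end

context tight_wheel_tree
begin

text \<open>No arc surrounds a maximal one, so all arcs lie between \<open>a\<close> and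
  \<open>a + H\<close>. The resulting number of radial edges is what excludes a maximal arc in
  \<open>T0\<close>.\<close>

lemma single_top_radials:
  assumes a: "L a" "0 \<le> a" "a < l" and only: "\<And>p. L p \<Longrightarrow> N dvd p - a"
    and top: "\<And>r s. \<lbrakk>arc r s; r \<le> a; a + H \<le> s\<rbrakk> \<Longrightarrow> r = a \<and> s = a + H"
  shows "\<lbrakk>a + H < r; r < a + N\<rbrakk> \<Longrightarrow> rad r" and "rad a \<or> rad (a + H)"
proof -
  have a0: "a div l = 0" using a by simp
  have sh: "\<exists>x. (x = 0 \<or> x \<ge> N \<or> x \<le> - N) \<and> a \<le> r + x \<and> s + x \<le> a + H"
    if rs: "arc r s" for r s
  proof -
    obtain x where x: "x = 0 \<or> x \<ge> N \<or> x \<le> - N" "arc (r + x) (s + x)"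
      "a \<le> r + x \<and> s + x \<le> a + H \<or>
       0 \<le> r + x \<and> r + x \<le> a \<and> a + H \<le> s + x \<and> s + x < H + l"
      using shape[of r s "{a}"] rs only a0 by auto
    then have "a \<le> r + x \<and> s + x \<le> a + H" using top[OF x(2)] by auto
    then show ?thesis using x(1) by blast
  qed
  show "rad r" if "a + H < r" "r < a + N" for r
  proof (rule ccontr)
    assume "\<not> rad r"
    then consider t where "r < t" "t < r + N" "arc r t" | t where "t < r" "r < t + N" "arc t r"
      using exit1[of r] by blast
    then show False
    proof cases
      case 1 then show False using sh[OF 1(3)] that a H_ge N_def by (elim exE conjE disjE) linarith+
    next
      case 2 then show False using sh[OF 2(3)] that a H_ge N_def by (elim exE conjE disjE) linarith+
    qed
  qed
  obtain r where r: "a \<le> r" "r \<le> a + H" "rad r \<or> (\<exists>t. a + H < t \<and> t < a + N \<and> arc r t) \<or>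
      (\<exists>t<a. a + H < t + N \<and> arc t r)"
    using exit[of a "a + H"] H_ge l_ge by (auto simp: N_def)
  from r(3) show "rad a \<or> rad (a + H)"
  proof (elim disjE exE conjE)
    assume "rad r"
    then have "\<not> (a < r \<and> r < a + H)" using rad_outside[OF a(1)] by blast
    then show ?thesis using r \<open>rad r\<close> by (cases "r = a") auto
  next
    fix t assume "a + H < t" "t < a + N" "arc r t"
    then show ?thesis using sh[of r t] r a H_ge N_def by (elim exE conjE disjE) linarith+
  next
    fix t assume "t < a" "a + H < t + N" "arc t r"
    then show ?thesis using sh[of t r] r a H_ge N_def by (elim exE conjE disjE) linarith+
  qed
qed

text \<open>The two gaps between the arcs add up to \<open>N - 2 * H = l\<close>, so the starts are
  \<open>h\<close> or \<open>h + 1\<close> groups apart. In the second case the distance from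
  \<open>q\<close> on to \<open>p + N\<close> is \<open>h\<close>.\<close>

lemma two_L_tree_if_card:
  assumes "card Ls = 2"
  shows "\<exists>p q. two_L_tree h l N H arc rad p q"
proof -
  obtain p q where pq: "Ls = {p, q}" "p < q"
    using assms by (metis card_2_iff insert_commute linorder_neqE)
  have L: "L p" "L q" "0 \<le> p" "q < N" using pq(1) by (auto simp: Ls_def)
  have only: "N dvd r - p \<or> N dvd r - q" if "L r" for r
  proof -
    have "r mod N \<in> Ls" using that L_mod N_pos by (auto simp: Ls_def)
    then have "r mod N = p \<or> r mod N = q" using pq by blast
    then show ?thesis by (metis dvd_minus_mod)
  qed
  have LN: "L (p + N)" using L(1) arc_period[of p "p + H"] by (simp add: algebra_simps)
  have 1: "p + H \<le> q" using L_eq[OF L(1,2), of q] pq by linarith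
  have 2: "q + H \<le> p + N" using L_eq[OF L(2) LN, of "p + N"] pq L by linarith
  have "p div l + h \<le> q div l" using zdiv_mono1[OF 1, of l] l_ge by simp
  moreover have "q div l \<le> p div l + h + 1"
  proof -
    have "q \<le> p + H + l" using 2 by (simp add: N_def)
    then have "q div l \<le> (p + H + l) div l" using l_ge by (intro zdiv_mono1) auto
    then show ?thesis using l_ge by simp
  qed
  ultimately consider "q div l = p div l + h" | "q div l = p div l + h + 1" by linarith
  then show ?thesis
  proof cases
    case 1
    have "two_L_tree h l N H arc rad p q"
      by unfold_locales (use L 1 \<open>p + H \<le> q\<close> only in auto)
    then show ?thesis by blast
  next
    case 2
    have "(p + N) div l = p div l + (2 * h + 1)" using div_add_N[of p 1] by simp
    moreover have "N dvd r - (p + N) \<longleftrightarrow> N dvd r - p" for r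
    proof -
      have "r - p = (r - (p + N)) + N" by simp
      then show ?thesis by (metis dvd_add_left_iff dvd_refl)
    qed
    ultimately have "two_L_tree h l N H arc rad q (p + N)"
      by unfold_locales (use L 2 \<open>q + H \<le> p + N\<close> only LN in auto)
    then show ?thesis by blast
  qed
qed

end

section \<open>Counting over a partition\<close>

lemma sum_card_ex1:
  assumes "finite I" "finite A" "\<And>a. a \<in> A \<Longrightarrow> \<exists>!i. i \<in> I \<and> Q i a"
  shows "(\<Sum>i\<in>I. card {a \<in> A. Q i a}) = card A"
proof -
  have "card (\<Union>i\<in>I. {a \<in> A. Q i a}) = (\<Sum>i\<in>I. card {a \<in> A. Q i a})"
  proof (rule card_UN_disjoint)
    show "\<forall>i\<in>I. \<forall>j\<in>I. i \<noteq> j \<longrightarrow> {a \<in> A. Q i a} \<inter> {a \<in> A. Q j a} = {}"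
      using assms(3) by blast
  qed (use assms in auto)
  moreover have "(\<Union>i\<in>I. {a \<in> A. Q i a}) = A" using assms(3) by blast
  ultimately show ?thesis by simp
qed

locale wheel_family = wheel_index +
  fixes I :: "'a set" and arc :: "'a \<Rightarrow> int \<Rightarrow> int \<Rightarrow> bool" and rad :: "'a \<Rightarrow> int \<Rightarrow> bool"
  assumes fin: "finite I" and card_I: "2 * int (card I) = N + 1"
    and trees: "i \<in> I \<Longrightarrow> wheel_tree h l N H (arc i) (rad i)"
    and arc_ex1: "\<lbrakk>p < q; q div l \<le> p div l + h\<rbrakk> \<Longrightarrow> \<exists>!i. i \<in> I \<and> arc i p q"
    and rad_ex1: "\<exists>!i. i \<in> I \<and> rad i r"
begin

definition "Lset i = {p \<in> {0..<N}. arc i p (p + H)}"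
definition "Bset i = {r \<in> {0..<N}. arc i r (r + 1)}"

lemma sum_L: "(\<Sum>i\<in>I. card (Lset i)) = nat N"
proof -
  have "\<exists>!i. i \<in> I \<and> arc i p (p + H)" for p
    using H_ge l_ge by (intro arc_ex1) auto
  then show ?thesis using sum_card_ex1[of I "{0..<N}"] fin by (simp add: Lset_def)
qed

lemma sum_B: "(\<Sum>i\<in>I. card (Bset i)) = nat N"
proof -
  have "\<exists>!i. i \<in> I \<and> arc i p (p + 1)" for p
  proof (rule arc_ex1)
    have "(p + 1) div l \<le> (p + H) div l" using H_ge l_ge by (intro zdiv_mono1) auto
    then show "(p + 1) div l \<le> p div l + h" by simp
  qed simp
  then show ?thesis using sum_card_ex1[of I "{0..<N}"] fin by (simp add: Bset_def)
qed

lemma Lset_eq: "i \<in> I \<Longrightarrow> Lset i = wheel_tree.Ls N H (arc i)"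
  and Bset_eq: "i \<in> I \<Longrightarrow> Bset i = wheel_tree.Bs N (arc i)"
  using wheel_tree.Ls_def[OF trees] wheel_tree.Bs_def[OF trees] by (simp_all add: Lset_def Bset_def)

lemma card_L_le_B: "i \<in> I \<Longrightarrow> card (Lset i) \<le> card (Bset i)"
  using wheel_tree.card_Ls_le[OF trees] Lset_eq Bset_eq by simp

lemma card_L_eq_B: "i \<in> I \<Longrightarrow> card (Lset i) = card (Bset i)"
  using sum_mono_inv[of "\<lambda>i. card (Lset i)" I "\<lambda>i. card (Bset i)"] sum_L sum_B card_L_le_B fin
  by auto

lemma tight: "i \<in> I \<Longrightarrow> tight_wheel_tree h l N H (arc i) (rad i)"
  using wheel_tree.tight_if_card[OF trees] Lset_eq Bset_eq card_L_eq_B by metis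

lemma card_L_le_2: "i \<in> I \<Longrightarrow> card (Lset i) \<le> 2"
  using wheel_tree.card_Ls_le_2[OF trees] Lset_eq by simp

text \<open>The total \<open>N = 2 * card I - 1\<close> falls short of two per tree by one
  only.\<close>

lemma card_L_eq_2:
  assumes "i \<in> I" "card (Lset i) \<le> 1" "j \<in> I" "j \<noteq> i"
  shows "card (Lset j) = 2"
proof (rule ccontr)
  assume "card (Lset j) \<noteq> 2"
  then have j: "card (Lset j) \<le> 1" using card_L_le_2[OF assms(3)] by linarith
  have "(\<Sum>i\<in>I. card (Lset i)) = card (Lset i) + (card (Lset j) + (\<Sum>k\<in>I - {i} - {j}. card (Lset k)))"
    using fin assms by (simp add: sum.remove[of I i] sum.remove[of "I - {i}" j])
  also have "\<dots> \<le> 1 + (1 + 2 * card (I - {i} - {j}))"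
    using assms(2) j card_L_le_2 sum_bounded_above[of "I - {i} - {j}" "\<lambda>k. card (Lset k)" 2]
    by (intro add_mono) auto
  also have "card (I - {i} - {j}) = card I - 2"
    using assms fin by (simp add: card_Diff_singleton)
  finally have "nat N \<le> 2 + 2 * (card I - 2)" using sum_L by simp
  moreover have "card I \<ge> 2"
    using assms fin card_mono[of I "{i, j}"] by simp
  ultimately show False using card_I N_pos by linarith
qed

lemma ex_single: "\<exists>i\<in>I. card (Lset i) = 1"
proof -
  have "\<exists>i\<in>I. card (Lset i) \<noteq> 2"
  proof (rule ccontr)
    assume "\<not> ?thesis"
    then have "nat N = 2 * card I" using sum_L by (simp add: mult.commute)
    then show False using card_I N_pos by linarith
  qed
  then obtain i where i: "i \<in> I" "card (Lset i) \<le> 1" using card_L_le_2 by fastforce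
  have "(\<Sum>i\<in>I. card (Lset i)) = card (Lset i) + (\<Sum>k\<in>I - {i}. card (Lset k))"
    using fin i by (simp add: sum.remove[of I i])
  also have "\<dots> \<le> card (Lset i) + 2 * card (I - {i})"
    using card_L_le_2 sum_bounded_above[of "I - {i}" "\<lambda>k. card (Lset k)" 2] by auto
  also have "card (I - {i}) = card I - 1" using i fin by simp
  finally have "nat N \<le> card (Lset i) + 2 * (card I - 1)" using sum_L by simp
  moreover have "card I \<ge> 1" using i fin by (metis One_nat_def Suc_leI card_gt_0_iff empty_iff)
  ultimately have "card (Lset i) \<ge> 1" using card_I N_pos by linarith
  then show ?thesis using i by (intro bexI[of _ i]) auto
qed

lemma wheel_tree_shift:
  assumes "wheel_tree h l N H A R"
  shows "wheel_tree h l N H (\<lambda>p q. A (p + g * l) (q + g * l)) (\<lambda>r. R (r + g * l))"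
proof -
  interpret wheel_tree h l N H A R by fact
  let ?d = "g * l"
  show ?thesis
  proof unfold_locales
    fix p q assume a: "A (p + ?d) (q + ?d)"
    show "p < q" using arc_less[OF a] by simp
    show "q div l \<le> p div l + h" using arc_short[OF a] l_ge by simp
  next
    fix p q show "A (p + N + ?d) (q + N + ?d) = A (p + ?d) (q + ?d)"
      using arc_period[of "p + ?d" "q + ?d"] by (simp add: algebra_simps)
  next
    fix r show "R (r + N + ?d) = R (r + ?d)"
      using rad_period[of "r + ?d"] by (simp add: algebra_simps)
  next
    fix p q r s assume "A (p + ?d) (q + ?d)" "A (r + ?d) (s + ?d)" "p < r" "r < q"
    then show "s \<le> q" using laminar[of "p + ?d" "q + ?d" "r + ?d" "s + ?d"] by simp
  next
    fix p q r assume "A (p + ?d) (q + ?d)" "p < r" "r < q"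
    then show "\<not> R (r + ?d)" using rad_outside by auto
  next
    fix x y assume "x \<le> y" "y < x + N"
    then obtain r where r: "x + ?d \<le> r" "r \<le> y + ?d"
      "R r \<or> (\<exists>t. y + ?d < t \<and> t < x + ?d + N \<and> A r t) \<or> (\<exists>t. t < x + ?d \<and> y + ?d < t + N \<and> A t r)"
      using exit[of "x + ?d" "y + ?d"] by auto
    define r' where "r' = r - ?d"
    have r': "r = r' + ?d" "x \<le> r'" "r' \<le> y" using r by (auto simp: r'_def)
    from r(3) have "R r \<or> (\<exists>t. y < t \<and> t < x + N \<and> A r (t + ?d)) \<or>
       (\<exists>t. t < x \<and> y < t + N \<and> A (t + ?d) r)"
    proof (elim disjE exE conjE)
      fix t assume "y + ?d < t" "t < x + ?d + N" "A r t"
      then have "y < t - ?d \<and> t - ?d < x + N \<and> A r (t - ?d + ?d)" by simp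
      then show ?thesis by blast
    next
      fix t assume "t < x + ?d" "y + ?d < t + N" "A t r"
      then have "t - ?d < x \<and> y < t - ?d + N \<and> A (t - ?d + ?d) r" by simp
      then show ?thesis by blast
    qed simp
    then show "\<exists>r. x \<le> r \<and> r \<le> y \<and> (R (r + ?d) \<or> (\<exists>t>y. t < x + N \<and> A (r + ?d) (t + ?d)) \<or>
       (\<exists>t<x. y < t + N \<and> A (t + ?d) (r + ?d)))"
      using r' by blast
  next
    fix p q r assume "A (p + ?d) (q + ?d)" "A (q + ?d) (r + ?d)"
    then show "\<not> A (r + ?d) (p + N + ?d)"
      using no_triangle[of "p + ?d" "q + ?d" "r + ?d"] by (simp add: algebra_simps)
  qed
qed

text \<open>Rotation by whole groups, so that the arc of \<open>T0\<close> may be assumed to start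
  in group \<open>0\<close>.\<close>

lemma family_shift:
  "wheel_family h l N H I (\<lambda>i p q. arc i (p + g * l) (q + g * l)) (\<lambda>i r. rad i (r + g * l))"
proof (intro wheel_family.intro wheel_family_axioms.intro)
  fix p q :: int assume "p < q" "q div l \<le> p div l + h"
  then show "\<exists>!i. i \<in> I \<and> arc i (p + g * l) (q + g * l)"
    using l_ge by (intro arc_ex1) auto
qed (use wheel_index_axioms fin card_I wheel_tree_shift[OF trees] rad_ex1 in simp_all)

definition "owner x = (THE i. i \<in> I \<and> arc i x (x + H))"

lemma owner: "owner x \<in> I" "arc (owner x) x (x + H)"
  and owner_eq: "\<lbrakk>i \<in> I; arc i x (x + H)\<rbrakk> \<Longrightarrow> owner x = i"
proof -
  have ex1: "\<exists>!i. i \<in> I \<and> arc i x (x + H)" using H_ge l_ge by (intro arc_ex1) auto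
  show "owner x \<in> I" "arc (owner x) x (x + H)"
    using theI'[OF ex1] by (simp_all add: owner_def)
  show "owner x = i" if "i \<in> I" "arc i x (x + H)" for i
    using that ex1 by (auto simp: owner_def intro: the1_equality)
qed

text \<open>Arcs of length \<open>H\<close> starting in one group overlap because
  \<open>l \<le> H\<close>, so a tree contains at most one of them; hence exactly \<open>l\<close>
  trees have an arc of length \<open>H\<close> from group \<open>0\<close>.\<close>

lemma inj_owner: "inj_on owner {0..<l}"
proof
  fix x y assume xy: "x \<in> {0..<l}" "y \<in> {0..<l}" "owner x = owner y"
  interpret wheel_tree h l N H "arc (owner x)" "rad (owner x)" using trees owner by blast
  have "L y" using owner(2)[of y] xy by simp
  then show "x = y" using L_eq[OF owner(2)[of x], of y "max x y"] xy H_ge by auto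
qed

text \<open>\<open>c * (2 * h + 1)\<close> is group \<open>0\<close> in the periodic
  numbering.\<close>

lemma owner_group:
  assumes "i \<in> I" "arc i p (p + H)" "p div l = c * (2 * h + 1)"
  shows "i \<in> owner ` {0..<l}"
proof -
  interpret wheel_tree h l N H "arc i" "rad i" using trees assms by blast
  define x where "x = p - c * N"
  have "L x" using assms(2) arc_period_mult[of p "-c" "p + H"] by (simp add: x_def algebra_simps)
  then have "owner x = i" using owner_eq assms by blast
  moreover have "x div l = 0" using div_add_N[of p "-c"] assms(3) by (simp add: x_def)
  then have "x \<in> {0..<l}" using div_eq_iff[of x 0] by simp
  ultimately show ?thesis by blast
qed

text \<open>
  Outer points that are not the first or last point of their group, in the two groups joined by the
  longest edge of the tree with a single boundary edge. Too few trees can offer a radial edge to them.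
\<close>

definition "is_inner r \<longleftrightarrow> (1 \<le> r \<and> r \<le> l - 2) \<or> (H + 1 \<le> r \<and> r \<le> H + l - 2)"

lemma inner_mod: "is_inner r \<Longrightarrow> r mod l \<noteq> 0 \<and> r mod l \<noteq> l - 1"
  and inner_div: "is_inner r \<Longrightarrow> r div l = 0 \<or> r div l = h"
proof -
  assume "is_inner r"
  then have "\<exists>y c. r = y + c * l \<and> 1 \<le> y \<and> y \<le> l - 2 \<and> (c = 0 \<or> c = h)"
    unfolding is_inner_def
  proof
    assume "1 \<le> r \<and> r \<le> l - 2"
    then show ?thesis by (intro exI[of _ r] exI[of _ 0]) auto
  next
    assume "H + 1 \<le> r \<and> r \<le> H + l - 2"
    then show ?thesis by (intro exI[of _ "r - H"] exI[of _ h]) (auto simp: H_def)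
  qed
  then obtain y c where y: "r = y + c * l" "1 \<le> y" "y \<le> l - 2" "c = 0 \<or> c = h" by blast
  have "r mod l = y" using y(1-3) by (simp add: mod_pos_pos_trivial)
  then show "r mod l \<noteq> 0 \<and> r mod l \<noteq> l - 1" using y by linarith
  have "r div l = c" using y(1-3) by (simp add: div_pos_pos_trivial)
  then show "r div l = 0 \<or> r div l = h" using y(4) by simp
qed

lemma mod_N_mod_l: "(r mod N) mod l = r mod l"
  by (simp add: N_eq mod_mod_cancel)

definition "Outer = {r \<in> {0..<N}. \<not> is_inner r}"

lemma finite_Outer: "finite Outer" by (rule finite_subset[of _ "{0..<N}"]) (auto simp: Outer_def)

lemma card_Outer: "int (card Outer) = N - 2 * (l - 2)"
proof -
  have "Outer = {0..<N} - ({1..l - 2} \<union> {H + 1..H + l - 2})" by (auto simp: Outer_def is_inner_def)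
  moreover have "card ({1..l - 2} \<union> {H + 1..H + l - 2}) = nat (l - 2) + nat (l - 2)"
    using H_ge by (subst card_Un_disjoint) auto
  moreover have "{1..l - 2} \<union> {H + 1..H + l - 2} \<subseteq> {0..<N}"
    using H_ge l_ge by (auto simp: N_def)
  ultimately show ?thesis
    using H_ge l_ge by (simp add: card_Diff_subset N_def of_nat_diff)
qed

definition "outer_radials i = card {r \<in> Outer. rad i r}"

lemma sum_outer_radials: "(\<Sum>i\<in>I. outer_radials i) = card Outer"
  unfolding outer_radials_def using sum_card_ex1[of I Outer rad] fin finite_Outer rad_ex1 by auto

lemma outer_radials_pos:
  assumes "i \<in> I" "rad i r" "\<not> is_inner (r mod N)"
  shows "outer_radials i \<ge> 1"
proof -
  interpret wheel_tree h l N H "arc i" "rad i" using trees assms by blast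
  have "r mod N \<in> {r \<in> Outer. rad i r}" using assms rad_mod N_pos by (simp add: Outer_def)
  moreover have "finite {r \<in> Outer. rad i r}" using finite_Outer by simp
  ultimately show ?thesis unfolding outer_radials_def
    by (metis One_nat_def Suc_leI card_gt_0_iff empty_iff)
qed

text \<open>Here \<open>A\<close> is group \<open>0\<close>, \<open>B\<close> is group
  \<open>h\<close> and \<open>i0\<close> is \<open>T0\<close>. The three contributions to the count
  come from \<open>i0\<close>, from the tree \<open>i1\<close> with a maximal arc from
  \<open>A\<close> to \<open>B\<close>, and from the trees in \<open>?Y\<close>, which have no arc
  of length \<open>H\<close> from \<open>A\<close> to \<open>B\<close>.\<close>

lemma le_3_if_first_group:
  assumes i0: "i0 \<in> I" and a: "arc i0 a (a + H)" "0 \<le> a" "a < l"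
    and only: "\<And>p. arc i0 p (p + H) \<Longrightarrow> N dvd p - a"
  shows "l \<le> 3"
proof -
  interpret T0: tight_wheel_tree h l N H "arc i0" "rad i0" using tight i0 .
  have "Lset i0 \<subseteq> {a}"
  proof
    fix p assume "p \<in> Lset i0"
    then have p: "0 \<le> p" "p < N" "N dvd p - a" using only by (auto simp: Lset_def)
    then have "p mod N = a mod N" using mod_eq_dvd_iff by blast
    moreover have "a < N" using a H_ge N_def l_ge by linarith
    ultimately have "p = a"
      using mod_pos_pos_trivial[of p N] mod_pos_pos_trivial[of a N] p a by metis
    then show "p \<in> {a}" by simp
  qed
  then have c0: "card (Lset i0) \<le> 1" using card_mono[of "{a}" "Lset i0"] by simp
  have two: "\<exists>p q. two_L_tree h l N H (arc j) (rad j) p q" if "j \<in> I" "j \<noteq> i0" for j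
  proof -
    interpret tight_wheel_tree h l N H "arc j" "rad j" using tight that by blast
    have "card Ls = 2" using card_L_eq_2[OF i0 c0] Lset_eq that by metis
    then show ?thesis by (rule two_L_tree_if_card)
  qed
  let ?Y = "I - owner ` {0..<l}"
  have Y: "outer_radials j \<ge> 1" if j: "j \<in> ?Y" for j
  proof -
    have "j \<noteq> i0" using owner_group[OF i0 a(1), of 0] a j by auto
    then obtain p q where "two_L_tree h l N H (arc j) (rad j) p q" using two j by blast
    then interpret two_L_tree h l N H "arc j" "rad j" p q .
    obtain r where r: "rad j r" "r mod l = 0 \<or> r mod l = l - 1 \<or> r div l = p div l + h"
      using ex_end_or_middle_radial by auto
    have "\<not> is_inner (r mod N)"
    proof
      assume m: "is_inner (r mod N)"
      then have "r div l = p div l + h" using inner_mod[OF m] r(2) mod_N_mod_l[of r] by simp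
      moreover have "r div l = (r mod N) div l + (r div N) * (2 * h + 1)"
        using div_add_N[of "r mod N" "r div N"] by simp
      \<comment> \<open>The middle group of \<open>j\<close> would be group \<open>0\<close> or
        \<open>h\<close> modulo the number of groups, so the arc at \<open>q\<close> or the arc at
        \<open>p\<close> would start in group \<open>0\<close>.\<close>
      ultimately consider "q div l = (r div N) * (2 * h + 1)" | "p div l = (r div N) * (2 * h + 1)"
        using inner_div[OF m] q_div by fastforce
      then show False
        using owner_group[of j] Lp Lq j by cases blast+
    qed
    then show ?thesis using outer_radials_pos j r by blast
  qed
  \<comment> \<open>An arc of length \<open>H + 1\<close> from group \<open>0\<close> still ends in
    group \<open>h\<close> unless it starts at the last point \<open>l - 1\<close>; hence only
    \<open>l - 1\<close> such trees for \<open>l\<close> values of \<open>owner\<close>.\<close>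
  define own1 where "own1 x = (THE i. i \<in> I \<and> arc i x (x + H + 1))" for x
  have own1: "own1 x = i" if "i \<in> I" "arc i x (x + H + 1)" "x \<in> {0..<l - 1}" for i x
  proof -
    have "(x + H + 1) div l \<le> x div l + h"
      using that(3) div_add_H[of "x + 1"] by (simp add: algebra_simps)
    then have "\<exists>!i. i \<in> I \<and> arc i x (x + H + 1)" using H_ge l_ge by (intro arc_ex1) auto
    then show ?thesis using that by (auto simp: own1_def intro: the1_equality)
  qed
  have "\<exists>x\<in>{0..<l}. owner x \<notin> own1 ` {0..<l - 1}"
  proof (rule ccontr)
    assume "\<not> ?thesis"
    then have "owner ` {0..<l} \<subseteq> own1 ` {0..<l - 1}" by auto
    then have "card (owner ` {0..<l}) \<le> card {0..<l - 1}"
      using surj_card_le by blast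
    then show False using card_image[OF inj_owner] l_ge by simp
  qed
  then obtain x where x: "x \<in> {0..<l}" "owner x \<notin> own1 ` {0..<l - 1}" by blast
  define i1 where "i1 = owner x"
  have i1: "i1 \<in> I" "arc i1 x (x + H)" using owner by (auto simp: i1_def)
  interpret T1: tight_wheel_tree h l N H "arc i1" "rad i1" using tight i1 by blast
  \<comment> \<open>A longer arc around could be peeled to one of length \<open>H + 1\<close>
    between the same two groups, putting \<open>i1\<close> in the image of
    \<open>own1\<close>.\<close>
  have top: "r = x \<and> s = x + H" if rs: "arc i1 r s" "r \<le> x" "x + H \<le> s" for r s
  proof (cases "s - r > H")
    case True
    obtain y where y: "r \<le> y" "y + H + 1 \<le> s" "arc i1 y (y + H + 1)"
      using T1.ex_length_Suc_H[OF rs(1) True] by blast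
    have "x div l = 0" using x by auto
    then have "0 \<le> r" "s < H + l" using T1.around[OF rs(1) i1(2) rs(2,3)] by auto
    then have "y \<in> {0..<l - 1}" using y by auto
    then have "i1 \<in> own1 ` {0..<l - 1}" using own1[OF i1(1) y(3)] by blast
    then show ?thesis using x by (simp add: i1_def)
  qed (use rs in linarith)
  \<comment> \<open>Otherwise \<open>i0\<close> has at least \<open>N - H\<close> radial edges and
    each other tree at least one, so \<open>card I - 1 \<le> H\<close>; but
    \<open>2 * card I = 2 * H + l + 1\<close> with \<open>l \<ge> 3\<close>.\<close>
  have "i1 \<noteq> i0"
  proof
    assume "i1 = i0"
    then have "N dvd x - a" using only i1 by blast
    then have "x mod N = a mod N" using mod_eq_dvd_iff by blast
    moreover have "x < N" "a < N" using x a H_ge N_def l_ge by auto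
    ultimately have "x = a" using x a by (simp add: mod_pos_pos_trivial)
    note rads = T0.single_top_radials[OF a only top[unfolded \<open>i1 = i0\<close> \<open>x = a\<close>], simplified]
    let ?A = "{a..<a + N}"
    have finA: "finite {r \<in> ?A. R r}" for R by (rule finite_subset[of _ ?A]) auto
    have "\<exists>y. y \<in> {a, a + H} \<and> {a + H<..<a + N} \<union> {y} \<subseteq> {r \<in> ?A. rad i0 r}"
      using rads H_ge l_ge N_def by auto
    then obtain y where y: "y \<in> {a, a + H}" "{a + H<..<a + N} \<union> {y} \<subseteq> {r \<in> ?A. rad i0 r}"
      by blast
    have "card ({a + H<..<a + N} \<union> {y}) = nat (N - H - 1) + 1"
      using y(1) H_ge l_ge by auto
    then have c0: "card {r \<in> ?A. rad i0 r} \<ge> nat (N - H - 1) + 1"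
      using card_mono[OF finA y(2)] by simp
    have c1: "card {r \<in> ?A. rad i r} \<ge> 1" if "i \<in> I" for i
    proof -
      have "\<exists>r. r \<in> {r \<in> ?A. rad i r}" using wheel_tree.ex_rad[OF trees[OF that], of a] by auto
      then show ?thesis using finA by (metis One_nat_def Suc_leI card_gt_0_iff empty_iff)
    qed
    have "nat N = (\<Sum>i\<in>I. card {r \<in> ?A. rad i r})"
      using sum_card_ex1[of I ?A rad] fin rad_ex1 by simp
    also have "\<dots> = card {r \<in> ?A. rad i0 r} + (\<Sum>i\<in>I - {i0}. card {r \<in> ?A. rad i r})"
      using fin i0 by (simp add: sum.remove)
    finally have "nat N \<ge> nat (N - H - 1) + 1 + card (I - {i0})"
      using c0 sum_bounded_below[of "I - {i0}" 1 "\<lambda>i. card {r \<in> ?A. rad i r}"] c1 by auto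
    moreover have "card (I - {i0}) = card I - 1" using fin i0 by simp
    ultimately show False using card_I N_def H_ge l_ge by linarith
  qed
  have nm1: "outer_radials i1 \<ge> 1"
  proof -
    obtain p q where "two_L_tree h l N H (arc i1) (rad i1) p q" using two i1 \<open>i1 \<noteq> i0\<close> by blast
    then interpret two_L_tree h l N H "arc i1" "rad i1" p q .
    have topc: "r = x + c * N \<and> s = x + c * N + H"
      if "arc i1 r s" "r \<le> x + c * N" "x + c * N + H \<le> s" for c r s
      using top[of "r - c * N" "s - c * N"] T1.arc_period_mult[of r "-c" s] that
      by (simp add: algebra_simps)
    have "\<exists>r. rad i1 r \<and> (r mod l = 0 \<or> r mod l = l - 1)"
    proof (cases "N dvd x - p")
      case True
      then obtain c where "x - p = N * c" by (auto elim: dvdE)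
      then have "p = x + (-c) * N" by (simp add: algebra_simps)
      then show ?thesis using ex_end_radial_if_top topc by metis
    next
      case False
      then have "N dvd x - q" using only i1 by blast
      then obtain c where "x - q = N * c" by (auto elim: dvdE)
      then have "q = x + (-c) * N" by (simp add: algebra_simps)
      then show ?thesis using ex_end_radial_if_top' topc by metis
    qed
    then show ?thesis using outer_radials_pos[OF i1(1)] inner_mod mod_N_mod_l by metis
  qed
  \<comment> \<open>The \<open>H\<close> points of the groups \<open>h + 1\<close> to
    \<open>2 * h\<close>, and one of \<open>0\<close> and \<open>H + l - 1\<close>.\<close>
  have nm0: "outer_radials i0 \<ge> nat (H + 1)"
  proof -
    note rads = T0.single_L_radials[OF a only, simplified]
    have "r \<in> Outer" if "r \<in> {H + l..<N} \<or> r = 0 \<or> r = H + l - 1" for r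
    proof -
      have "0 \<le> r" "r < N" "\<not> is_inner r"
        using that H_ge l_ge unfolding is_inner_def by (auto simp: N_def)
      then show ?thesis by (simp add: Outer_def)
    qed
    then have "\<exists>y. y \<in> {0, H + l - 1} \<and> {H + l..<N} \<union> {y} \<subseteq> {r \<in> Outer. rad i0 r}"
      using rads by auto
    then obtain y where y: "y \<in> {0, H + l - 1}" "{H + l..<N} \<union> {y} \<subseteq> {r \<in> Outer. rad i0 r}"
      by blast
    have "card ({H + l..<N} \<union> {y}) = nat H + 1"
      using y(1) H_ge l_ge by (auto simp: N_def)
    then show ?thesis using card_mono[OF _ y(2)] H_ge l_ge finite_Outer by (simp add: outer_radials_def)
  qed
  have "card ?Y \<ge> card I - nat l"
    using diff_card_le_card_Diff[of "owner ` {0..<l}" I] card_image[OF inj_owner] by simp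
  moreover have "card ?Y \<le> (\<Sum>i\<in>?Y. outer_radials i)"
    using sum_bounded_below[of ?Y 1 outer_radials] Y by simp
  moreover have "outer_radials i0 + outer_radials i1 + (\<Sum>i\<in>?Y. outer_radials i) \<le> (\<Sum>i\<in>I. outer_radials i)"
  proof -
    have "i0 \<in> owner ` {0..<l}" using owner_group[OF i0 a(1), of 0] a by auto
    moreover have "i1 \<in> owner ` {0..<l}" using x by (simp add: i1_def)
    ultimately have "outer_radials i0 + outer_radials i1 + (\<Sum>i\<in>?Y. outer_radials i) = (\<Sum>i\<in>{i0, i1} \<union> ?Y. outer_radials i)"
      using fin \<open>i1 \<noteq> i0\<close> by (subst sum.union_disjoint) auto
    also have "\<dots> \<le> (\<Sum>i\<in>I. outer_radials i)" using fin i0 i1 by (intro sum_mono2) auto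
    finally show ?thesis .
  qed
  ultimately have "nat (H + 1) + 1 + (card I - nat l) \<le> card Outer"
    using nm0 nm1 sum_outer_radials by linarith
  then have "int (nat (H + 1)) + 1 + int (card I - nat l) \<le> int (card Outer)" by linarith
  moreover have "int (nat (H + 1)) = H + 1" "int (card I) - l \<le> int (card I - nat l)"
    using H_ge l_ge by auto
  ultimately have "H + 1 + 1 + (int (card I) - l) \<le> int (card Outer)" by linarith
  \<comment> \<open>Doubled, so that \<open>2 * card I = N + 1\<close> can be inserted.\<close>
  then have "2 * H + 4 + 2 * int (card I) - 2 * l \<le> 2 * N - 4 * (l - 2)" using card_Outer by linarith
  then show ?thesis unfolding card_I by (simp add: N_def)
qed

end

theorem (in wheel_family) l_le_3: "l \<le> 3"
proof -
  obtain i0 where i0: "i0 \<in> I" "card (Lset i0) = 1" using ex_single by blast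
  then obtain b where b: "Lset i0 = {b}" by (auto simp: card_1_singleton_iff)
  define g where "g = b div l"
  define a where "a = b - g * l"
  interpret S: wheel_family h l N H I "\<lambda>i p q. arc i (p + g * l) (q + g * l)" "\<lambda>i r. rad i (r + g * l)"
    by (rule family_shift)
  interpret T: wheel_tree h l N H "arc i0" "rad i0" using trees i0 by blast
  show ?thesis
  proof (rule S.le_3_if_first_group)
    show "i0 \<in> I" by fact
    show "arc i0 (a + g * l) (a + H + g * l)" using b by (auto simp: a_def Lset_def)
    show "0 \<le> a" "a < l" using div_eq_iff[of b g] by (auto simp: a_def g_def)
  next
    fix p assume "arc i0 (p + g * l) (p + H + g * l)"
    then have "T.L (p + g * l)" by (simp add: algebra_simps)
    then have "(p + g * l) mod N \<in> Lset i0" using T.L_mod N_pos by (simp add: Lset_def)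
    then have "(p + g * l) mod N = b" using b by simp
    then have "N dvd p + g * l - b" by (metis dvd_minus_mod)
    then show "N dvd p - a" by (simp add: a_def algebra_simps)
  qed
qed

section \<open>Wheels\<close>

lemma connected_exit:
  assumes "graph_connected G" "a \<in> S" "a \<in> verts G" "b \<in> verts G" "b \<notin> S"
  shows "\<exists>x y. x \<in> S \<and> y \<notin> S \<and> {x, y} \<in> edges G"
proof -
  have "(a, b) \<in> {(x, y). {x, y} \<in> edges G}\<^sup>*"
    using assms by (auto simp: graph_connected_def)
  then show ?thesis using assms(2,5)
    by (induction rule: rtrancl_induct) blast+
qed

text \<open>On a cycle, a vertex of maximal rank would have both neighbours equal to its parent. The
  same comparison of ranks shows that an edge determines its lower vertex, hence the number of
  edges.\<close>

lemma tree_of_parents: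
  fixes f :: "'b \<Rightarrow> 'a" and rank :: "'b \<Rightarrow> nat"
  assumes inj: "inj_on f X" and z0: "z0 \<in> X"
    and par: "\<And>x. \<lbrakk>x \<in> X; x \<noteq> z0\<rbrakk> \<Longrightarrow> par x \<in> X \<and> rank (par x) < rank x"
  defines "E \<equiv> (\<lambda>x. {f x, f (par x)}) ` (X - {z0})"
  shows "tree (f ` X, E)" and "card E = card (X - {z0})"
proof -
  have neq: "f x \<noteq> f (par x)" if "x \<in> X" "x \<noteq> z0" for x
    using par[OF that] inj that by (metis inj_on_eq_iff less_irrefl)
  have simple: "simple_graph (f ` X, E)"
    unfolding simple_graph_def E_def using par neq by auto
  have to_root: "(f x, f z0) \<in> {(x, y). {x, y} \<in> E}\<^sup>*" if "x \<in> X" for x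
    using that
  proof (induction "rank x" arbitrary: x rule: less_induct)
    case less
    show ?case
    proof (cases "x = z0")
      case False
      then have "(f x, f (par x)) \<in> {(x, y). {x, y} \<in> E}" using less.prems by (auto simp: E_def)
      moreover have "(f (par x), f z0) \<in> {(x, y). {x, y} \<in> E}\<^sup>*"
        using less par False by blast
      ultimately show ?thesis by (rule converse_rtrancl_into_rtrancl)
    qed simp
  qed
  have "sym {(x, y). {x, y} \<in> E}" by (auto simp: sym_def insert_commute)
  then have from_root: "(f z0, f x) \<in> {(x, y). {x, y} \<in> E}\<^sup>*" if "x \<in> X" for x
    using to_root[OF that] sym_rtrancl by (metis symD)
  have conn: "graph_connected (f ` X, E)"
    unfolding graph_connected_def using z0 to_root from_root by (auto intro: rtrancl_trans)
  define rk where "rk v = rank (inv_into X f v)" for v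
  have rk: "rk (f x) = rank x" if "x \<in> X" for x using that inj by (simp add: rk_def)
  have up: "\<exists>x\<in>X. v = f x \<and> w = f (par x)" if vw: "{v, w} \<in> E" "rk w \<le> rk v" for v w
  proof -
    obtain x where x: "x \<in> X" "x \<noteq> z0" "{v, w} = {f x, f (par x)}"
      using vw(1) unfolding E_def by blast
    have "rk (f (par x)) < rk (f x)" using par[OF x(1,2)] rk x(1) by simp
    then show ?thesis using x vw(2) by (auto simp: doubleton_eq_iff)
  qed
  have acyclic: "\<not> graph_cycle (f ` X, E) c" for c
  proof
    assume c: "graph_cycle (f ` X, E) c"
    define n where "n = length c"
    have n: "n \<ge> 3" "distinct c" and e: "\<And>i. i < n \<Longrightarrow> {c ! i, c ! (Suc i mod n)} \<in> E"
      using c by (auto simp: graph_cycle_def n_def)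
    obtain i where i: "i < n" "\<And>j. j < n \<Longrightarrow> rk (c ! j) \<le> rk (c ! i)"
    proof -
      have ne: "(\<lambda>j. rk (c ! j)) ` {..<n} \<noteq> {}"
      proof -
        have "0 \<in> {..<n}" using n by simp
        then show ?thesis by blast
      qed
      then have "Max ((\<lambda>j. rk (c ! j)) ` {..<n}) \<in> (\<lambda>j. rk (c ! j)) ` {..<n}"
        by (intro Max_in) auto
      then obtain i where "i < n" "Max ((\<lambda>j. rk (c ! j)) ` {..<n}) = rk (c ! i)" by auto
      then show thesis using that[of i] Max_ge[of "(\<lambda>j. rk (c ! j)) ` {..<n}"] by auto
    qed
    define j where "j = (if i = 0 then n - 1 else i - 1)"
    have j: "j < n" "Suc j mod n = i" using i n by (auto simp: j_def)
    have nx: "Suc i mod n < n" "Suc i mod n \<noteq> j"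
      using i n by (auto simp: j_def mod_Suc split: if_splits)
    obtain x where x: "x \<in> X" "c ! i = f x" "c ! (Suc i mod n) = f (par x)"
      using up[OF e[OF i(1)]] i(2) nx by blast
    have "{c ! i, c ! j} \<in> E" using e[OF j(1)] j(2) by (simp add: insert_commute)
    then obtain y where y: "y \<in> X" "c ! i = f y" "c ! j = f (par y)"
      using up i(2) j(1) by blast
    have "x = y" using x y inj by (simp add: inj_on_eq_iff)
    then have "c ! j = c ! (Suc i mod n)" using x y by simp
    then show False using n nx j(1) by (simp add: nth_eq_iff_index_eq n_def)
  qed
  show "tree (f ` X, E)" unfolding tree_def using simple conn acyclic by blast
  have "inj_on (\<lambda>x. {f x, f (par x)}) (X - {z0})"
  proof
    fix x y assume *: "x \<in> X - {z0}" "y \<in> X - {z0}" "{f x, f (par x)} = {f y, f (par y)}"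
    have "rk (f (par x)) < rk (f x)" "rk (f (par y)) < rk (f y)"
      using * par rk by simp_all
    then have "f x = f y" using *(3) by (auto simp: doubleton_eq_iff)
    then show "x = y" using * inj by (simp add: inj_on_eq_iff)
  qed
  then show "card E = card (X - {z0})" unfolding E_def by (rule card_image)
qed

text \<open>Removing a common element from one of the two sets keeps the union but lowers the sum of
  the cardinalities.\<close>

lemma disjoint_if_sum_card_le:
  assumes "finite I" "\<And>i. i \<in> I \<Longrightarrow> finite (E i)" "(\<Sum>i\<in>I. card (E i)) \<le> card (\<Union>i\<in>I. E i)"
    "i \<in> I" "j \<in> I" "i \<noteq> j"
  shows "E i \<inter> E j = {}"
proof (rule ccontr)
  assume "E i \<inter> E j \<noteq> {}"
  then obtain e where e: "e \<in> E i" "e \<in> E j" by blast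
  define F where "F = E(j := E j - {e})"
  have "(\<Union>k\<in>I. E k) = (\<Union>k\<in>I. F k)"
    using e assms(4-6) by (auto simp: F_def split: if_splits)
  then have "card (\<Union>k\<in>I. E k) \<le> (\<Sum>k\<in>I. card (F k))"
    using card_UN_le[OF assms(1), of F] by simp
  also have "\<dots> < (\<Sum>k\<in>I. card (E k))"
  proof (rule sum_strict_mono_ex1)
    show "\<forall>k\<in>I. card (F k) \<le> card (E k)"
      using assms(2) by (auto simp: F_def intro: card_mono)
    have "card (F j) < card (E j)"
      using card_Diff1_less[OF assms(2)[OF assms(5)] e(2)] by (simp only: F_def fun_upd_same)
    then show "\<exists>k\<in>I. card (F k) < card (E k)" using assms(5) by blast
  qed fact
  finally show False using assms(3) by simp
qed

text \<open>The interface between combinatorics and geometry: both directions of the theorem use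
  only which edges cross. The weak inequalities in the non-crossing assumptions admit shared
  endpoints.\<close>

locale wheel = wheel_index +
  fixes P :: "int \<Rightarrow> complex" and v0 :: complex
  assumes P_eq_iff: "P p = P q \<longleftrightarrow> N dvd p - q"
    and P_neq: "P p \<noteq> v0"
    and chords_cross: "\<lbrakk>p < q; q < r; r < s; s < p + N\<rbrakk> \<Longrightarrow> edges_cross {P p, P r} {P q, P s}"
    and chords_no_cross: "\<lbrakk>p < q; q \<le> r; r < s; s \<le> p + N\<rbrakk> \<Longrightarrow> \<not> edges_cross {P p, P q} {P r, P s}"
    and radial_cross: "\<lbrakk>q div l \<le> p div l + h; p < r; r < q\<rbrakk> \<Longrightarrow> edges_cross {v0, P r} {P p, P q}"
    and radial_no_cross: "\<lbrakk>q div l \<le> p div l + h; p < q; q \<le> r; r \<le> p + N\<rbrakk>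
      \<Longrightarrow> \<not> edges_cross {v0, P r} {P p, P q}"
    and radials_no_cross: "\<not> edges_cross {v0, P r} {v0, P s}"
begin

definition "V = insert v0 (range P)"

lemma P_add_N [simp]: "P (p + N) = P p"
  using P_eq_iff by simp

lemma P_mult: "P (p + c * N) = P p"
  using P_eq_iff by simp

lemma P_inj_window: "\<lbrakk>p < q; q < p + N\<rbrakk> \<Longrightarrow> P p \<noteq> P q"
  using P_eq_iff[of q p] zdvd_not_zless[of "q - p" N] by auto

lemma P_window: "\<exists>t. r \<le> t \<and> t < r + N \<and> P t = P s"
  by (rule periodic_window) simp

text \<open>A chord is read as an arc in the direction in which it is short, so that its inner
  points are those cut off from the centre.\<close>

lemma spanning_tree_index:
  assumes "spanning_tree T (complete_graph V)" "plane_graph T"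
  shows "wheel_tree h l N H
    (\<lambda>p q. p < q \<and> q div l \<le> p div l + h \<and> {P p, P q} \<in> edges T) (\<lambda>r. {v0, P r} \<in> edges T)"
proof -
  let ?A = "\<lambda>p q. p < q \<and> q div l \<le> p div l + h \<and> {P p, P q} \<in> edges T"
  have verts: "verts T = V" and conn: "graph_connected T" and cyc: "\<And>c. \<not> graph_cycle T c"
    and sub: "edges T \<subseteq> {e. e \<subseteq> V \<and> card e = 2}"
    using assms(1) by (auto simp: spanning_tree_def complete_graph_def tree_def subgraph_def)
  have plane: "\<not> edges_cross e f" if "e \<in> edges T" "f \<in> edges T" for e f
    using assms(2) that by (auto simp: plane_graph_def)
  have per: "(p + N) div l = p div l + (2 * h + 1)" for p using div_add_N[of p 1] by simp
  show ?thesis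
  proof (intro wheel_tree.intro wheel_tree_axioms.intro wheel_index_axioms)
    fix p q r s assume *: "?A p q" "?A r s" "p < r" "r < q"
    show "s \<le> q"
    proof (rule ccontr)
      assume "\<not> s \<le> q"
      \<comment> \<open>Two overlapping short arcs together advance at most \<open>2 * h\<close>
        groups, less than a full turn, so their four ends are in the cyclic order that makes the
        chords cross.\<close>
      have "r div l \<le> q div l" using * l_ge by (intro zdiv_mono1) auto
      moreover have "s div l \<le> r div l + h" "q div l \<le> p div l + h" using * by simp_all
      ultimately have "s div l < (p + N) div l" using per[of p] by linarith
      then have "s < p + N" using zdiv_mono1[of "p + N" s l] l_ge by fastforce
      then have "edges_cross {P p, P q} {P r, P s}"
        using chords_cross[of p r q s] * \<open>\<not> s \<le> q\<close> by simp
      then show False using plane * by blast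
    qed
  next
    fix p q r assume "?A p q" "p < r" "r < q"
    then show "{v0, P r} \<notin> edges T" using plane radial_cross by blast
  next
    fix x y :: int assume xy: "x \<le> y" "y < x + N"
    define S where "S = P ` {x..y}"
    have "v0 \<notin> S" using P_neq by (auto simp: S_def)
    then obtain a b where ab: "a \<in> S" "b \<notin> S" "{a, b} \<in> edges T"
      using connected_exit[OF conn, of "P x" S v0] xy by (auto simp: S_def verts V_def)
    then obtain r where r: "x \<le> r" "r \<le> y" "a = P r" by (auto simp: S_def)
    have "b \<in> V" using ab sub by auto
    then consider "b = v0" | s where "b = P s" by (auto simp: V_def)
    then have "{v0, P r} \<in> edges T \<or> (\<exists>t>y. t < x + N \<and> ?A r t) \<or> (\<exists>t<x. y < t + N \<and> ?A t r)"
    proof cases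
      case 1 then show ?thesis using ab r by (simp add: insert_commute)
    next
      case 2
      \<comment> \<open>The neighbour is reached forwards as \<open>t\<close> or backwards as
        \<open>t - N\<close>, whichever side of the chord is short.\<close>
      obtain t where t: "r \<le> t" "t < r + N" "P t = b" using P_window[of r s] 2 by blast
      have out: "\<not> (x \<le> t \<and> t \<le> y)" using t ab by (auto simp: S_def)
      have out': "\<not> (x \<le> t - N \<and> t - N \<le> y)"
        using t ab P_add_N[of "t - N"] by (auto simp: S_def)
      have e: "{P r, P t} \<in> edges T" "{P (t - N), P r} \<in> edges T"
        using ab r t P_add_N[of "t - N"] by (simp_all add: insert_commute)
      from short_or[of t r] t consider "t div l \<le> r div l + h" | "(r + N) div l \<le> t div l + h" by force
      then show ?thesis
      proof cases
        case 1
        then show ?thesis using e t out out' r by (intro disjI2 disjI1 exI[of _ t]) auto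
      next
        case 2
        then have "r div l \<le> (t - N) div l + h" using per[of r] per[of "t - N"] by simp
        then show ?thesis using e t out out' r by (intro disjI2 exI[of _ "t - N"]) auto
      qed
    qed
    then show "\<exists>r. x \<le> r \<and> r \<le> y \<and> ({v0, P r} \<in> edges T \<or> (\<exists>t>y. t < x + N \<and> ?A r t) \<or>
       (\<exists>t<x. y < t + N \<and> ?A t r))" using r by blast
  next
    fix p q r assume *: "?A p q" "?A q r"
    show "\<not> ?A r (p + N)"
    proof
      assume **: "?A r (p + N)"
      then have "distinct [P p, P q, P r]"
        using * P_inj_window[of p q] P_inj_window[of q r] P_inj_window[of p r] by simp
      moreover have "{P p, P q} \<in> edges T" "{P q, P r} \<in> edges T" "{P r, P p} \<in> edges T"
        using * ** by simp_all
      ultimately have "graph_cycle T [P p, P q, P r]"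
        unfolding graph_cycle_def by (auto simp: less_Suc_eq_0_disj mod_Suc)
      then show False using cyc by blast
    qed
  qed (use per in \<open>auto simp: add.commute\<close>)
qed

lemma l_le_3_if_partition:
  assumes part: "graph_partition (complete_graph V) \<T>" and card: "2 * int (card \<T>) = N + 1"
    and trees: "\<And>T. T \<in> \<T> \<Longrightarrow> spanning_tree T (complete_graph V) \<and> plane_graph T"
  shows "l \<le> 3"
proof -
  have ex1: "\<exists>!T. T \<in> \<T> \<and> {a, b} \<in> edges T" if "a \<in> V" "b \<in> V" "a \<noteq> b" for a b
  proof -
    have "{a, b} \<in> \<Union> (edges ` \<T>)"
      using part that by (auto simp: graph_partition_def complete_graph_def)
    then obtain T where T: "T \<in> \<T>" "{a, b} \<in> edges T" by auto
    moreover have "T' = T" if "T' \<in> \<T>" "{a, b} \<in> edges T'" for T'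
    proof (rule ccontr)
      assume "T' \<noteq> T"
      then have "edges T' \<inter> edges T = {}" using part T that unfolding graph_partition_def by blast
      then show False using T that by blast
    qed
    ultimately show ?thesis by blast
  qed
  interpret F: wheel_family h l N H \<T>
    "\<lambda>T p q. p < q \<and> q div l \<le> p div l + h \<and> {P p, P q} \<in> edges T" "\<lambda>T r. {v0, P r} \<in> edges T"
  proof (intro wheel_family.intro wheel_family_axioms.intro wheel_index_axioms)
    show "finite \<T>" using card N_pos by (intro card_ge_0_finite) linarith
    show "2 * int (card \<T>) = N + 1" by fact
    show "\<exists>!T. T \<in> \<T> \<and> {v0, P r} \<in> edges T" for r
      using P_neq[of r] by (intro ex1) (auto simp: V_def)
  next
    fix p q assume pq: "p < q" "q div l \<le> p div l + h"
    then have "P p \<noteq> P q" using P_inj_window short_less by blast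
    then have "\<exists>!T. T \<in> \<T> \<and> {P p, P q} \<in> edges T" by (intro ex1) (auto simp: V_def)
    then show "\<exists>!T. T \<in> \<T> \<and> p < q \<and> q div l \<le> p div l + h \<and> {P p, P q} \<in> edges T"
      using pq by simp
  qed (use spanning_tree_index trees in blast)
  show ?thesis by (rule F.l_le_3)
qed

end

section \<open>The partition for groups of three points\<close>

text \<open>
  The centre is \<open>None\<close>. The remaining vertices \<open>0, \<dots>, 2 * H + 2\<close> run around the hull, starting with the
  first point of a group.
\<close>

definition star_parent :: "int \<Rightarrow> int \<Rightarrow> int option" where
  "star_parent H x = (if x = H + 2 \<or> x > H + 2 then None else if x = 0 then Some (H + 2)
    else if x = H + 1 then Some 0 else Some (H + 1))"

text \<open>Two fans with apexes \<open>H\<close> and \<open>2 * H + 2\<close>. The parameter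
  \<open>z\<close> connects the first fan through the chord from \<open>0\<close> to
  \<open>H + 1\<close>, or through the centre in the one place where that chord already belongs to
  the star.\<close>

definition middle_parent :: "int \<Rightarrow> int option \<Rightarrow> int \<Rightarrow> int option" where
  "middle_parent H z x = (if x = H + 1 then None else if x = 0 then z else if x = H then Some 0
    else if x < H then Some H else if x = 2 * H + 2 then Some (H + 1) else Some (2 * H + 2))"

definition first_parent :: "int \<Rightarrow> int \<Rightarrow> int option" where
  "first_parent H x = (if x = 0 then None else if x = H + 1 \<or> x = H + 2 then Some 0
    else if x \<le> H then Some (H + 1) else if x = 2 * H + 2 then Some (H + 2) else Some (2 * H + 2))"

definition last_parent :: "int \<Rightarrow> int \<Rightarrow> int option" where
  "last_parent H x = (if x = 2 * H + 2 then None else if x = H \<or> x = H + 1 then Some (2 * H + 2)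
    else if x = 2 * H + 1 then Some (H + 1) else if x < H then Some H else Some (2 * H + 1))"

definition chord_between :: "(int \<Rightarrow> int option) \<Rightarrow> int \<Rightarrow> int \<Rightarrow> int \<Rightarrow> bool" where
  "chord_between par N a b \<longleftrightarrow> 0 \<le> a \<and> a < b \<and> b < N \<and> (par a = Some b \<or> par b = Some a)"

text \<open>The second clause makes every chord short for \<open>H = 3 * h\<close>; it avoids
  division, so that it can be checked by linear arithmetic in \<open>H\<close>.\<close>

definition plane_parent :: "int \<Rightarrow> (int \<Rightarrow> int option) \<Rightarrow> bool" where
  "plane_parent H par \<longleftrightarrow>
    (\<forall>x y. 0 \<le> x \<longrightarrow> x < 2 * H + 3 \<longrightarrow> par x = Some y \<longrightarrow> 0 \<le> y \<and> y < 2 * H + 3 \<and> x \<noteq> y) \<and>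
    (\<forall>a b. chord_between par (2 * H + 3) a b \<longrightarrow>
      b \<le> a + H \<or> a = 0 \<and> b \<le> H + 2 \<or> (a = H \<or> a = H + 1) \<and> b \<le> 2 * H + 2) \<and>
    (\<forall>a b z. chord_between par (2 * H + 3) a b \<longrightarrow> par z = None \<longrightarrow> z \<le> a \<or> b \<le> z) \<and>
    (\<forall>a b c d. chord_between par (2 * H + 3) a b \<longrightarrow> chord_between par (2 * H + 3) c d \<longrightarrow>
      \<not> (a < c \<and> c < b \<and> b < d))"

definition ranked_parent :: "int \<Rightarrow> (int \<Rightarrow> int option) \<Rightarrow> bool" where
  "ranked_parent H par \<longleftrightarrow> (\<exists>rank :: int \<Rightarrow> nat. \<forall>x y. 0 \<le> x \<longrightarrow> x < 2 * H + 3 \<longrightarrow> par x = Some y \<longrightarrow> rank y < rank x)"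

text \<open>\<open>C\<close> describes the chords as explicit fans, so that the crossing condition
  does not unfold the parent function for two chords at once.\<close>

lemma plane_parentI:
  assumes "\<And>x y. \<lbrakk>0 \<le> x; x < 2 * H + 3; par x = Some y\<rbrakk> \<Longrightarrow> 0 \<le> y \<and> y < 2 * H + 3 \<and> x \<noteq> y"
    and "\<And>a b. chord_between par (2 * H + 3) a b \<Longrightarrow> C a b"
    and "\<And>a b. C a b \<Longrightarrow>
      b \<le> a + H \<or> a = 0 \<and> b \<le> H + 2 \<or> (a = H \<or> a = H + 1) \<and> b \<le> 2 * H + 2"
    and "\<And>a b z. \<lbrakk>C a b; par z = None\<rbrakk> \<Longrightarrow> z \<le> a \<or> b \<le> z"
    and "\<And>a b c d. \<lbrakk>C a b; C c d; a < c; c < b; b < d\<rbrakk> \<Longrightarrow> False"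
  shows "plane_parent H par"
  unfolding plane_parent_def
proof (intro conjI allI impI)
  fix a b c d assume "chord_between par (2 * H + 3) a b" "chord_between par (2 * H + 3) c d"
  then show "\<not> (a < c \<and> c < b \<and> b < d)" using assms(2,5) by metis
next
  fix a b assume "chord_between par (2 * H + 3) a b"
  then show "b \<le> a + H \<or> a = 0 \<and> b \<le> H + 2 \<or> (a = H \<or> a = H + 1) \<and> b \<le> 2 * H + 2"
    by (rule assms(3)[OF assms(2)])
next
  fix a b z assume "chord_between par (2 * H + 3) a b" "par z = None"
  then show "z \<le> a \<or> b \<le> z" by (rule assms(4)[OF assms(2)])
qed (use assms(1) in blast)+

lemma plane_star: "H \<ge> 3 \<Longrightarrow> plane_parent H (star_parent H)"
  by (rule plane_parentI[where C = "\<lambda>a b. a = 0 \<and> b = H + 2 \<or> 0 \<le> a \<and> a \<le> H \<and> b = H + 1"])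
    (auto simp: chord_between_def star_parent_def split: if_splits)

lemma plane_middle: "\<lbrakk>H \<ge> 3; z = None \<or> z = Some (H + 1)\<rbrakk> \<Longrightarrow> plane_parent H (middle_parent H z)"
  by (rule plane_parentI[where C = "\<lambda>a b. a = 0 \<and> b = H + 1 \<and> z \<noteq> None \<or> 0 \<le> a \<and> a < H \<and> b = H \<or>
      H + 1 \<le> a \<and> a \<le> 2 * H + 1 \<and> b = 2 * H + 2"])
    (auto simp: chord_between_def middle_parent_def split: if_splits)

lemma plane_first: "H \<ge> 3 \<Longrightarrow> plane_parent H (first_parent H)"
  by (rule plane_parentI[where C = "\<lambda>a b. a = 0 \<and> b = H + 2 \<or> 0 \<le> a \<and> a \<le> H \<and> b = H + 1 \<or>
      H + 2 \<le> a \<and> a \<le> 2 * H + 1 \<and> b = 2 * H + 2"])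
    (auto simp: chord_between_def first_parent_def split: if_splits)

lemma plane_last: "H \<ge> 3 \<Longrightarrow> plane_parent H (last_parent H)"
  by (rule plane_parentI[where C = "\<lambda>a b. (a = H \<or> a = H + 1) \<and> b = 2 * H + 2 \<or> 0 \<le> a \<and> a < H \<and> b = H \<or>
      H + 1 \<le> a \<and> a \<le> 2 * H \<and> b = 2 * H + 1"])
    (auto simp: chord_between_def last_parent_def split: if_splits)

lemma ranked_star: "H \<ge> 3 \<Longrightarrow> ranked_parent H (star_parent H)"
  unfolding ranked_parent_def star_parent_def
  by (rule exI[of _ "\<lambda>x. if x = H + 2 then 1 else if x = 0 then 2 else if x = H + 1 then 3 else 4"]) auto

lemma ranked_middle: "\<lbrakk>H \<ge> 3; z = None \<or> z = Some (H + 1)\<rbrakk> \<Longrightarrow> ranked_parent H (middle_parent H z)"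
  unfolding ranked_parent_def middle_parent_def
  by (rule exI[of _ "\<lambda>x. if x = H + 1 then 1 else if x = 0 \<or> x = 2 * H + 2 then 2 else if x = H then 3 else 4"]) auto

lemma ranked_first: "H \<ge> 3 \<Longrightarrow> ranked_parent H (first_parent H)"
  unfolding ranked_parent_def first_parent_def
  by (rule exI[of _ "\<lambda>x. if x = 0 then 1 else if x = H + 1 \<or> x = H + 2 then 2 else if x = 2 * H + 2 then 3 else 4"]) auto

lemma ranked_last: "H \<ge> 3 \<Longrightarrow> ranked_parent H (last_parent H)"
  unfolding ranked_parent_def last_parent_def
  by (rule exI[of _ "\<lambda>x. if x = 2 * H + 2 then 1 else if x = H \<or> x = H + 1 then 2 else if x = 2 * H + 1 then 3 else 4"]) auto

lemma edges_cross_commute: "edges_cross e f \<longleftrightarrow> edges_cross f e"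
  by (auto simp: edges_cross_def)

lemma plane_parentD:
  assumes "plane_parent H par"
  shows "\<lbrakk>0 \<le> x; x < 2 * H + 3; par x = Some y\<rbrakk> \<Longrightarrow> 0 \<le> y \<and> y < 2 * H + 3 \<and> x \<noteq> y"
    and "chord_between par (2 * H + 3) a b \<Longrightarrow>
      b \<le> a + H \<or> a = 0 \<and> b \<le> H + 2 \<or> (a = H \<or> a = H + 1) \<and> b \<le> 2 * H + 2"
    and "\<lbrakk>chord_between par (2 * H + 3) a b; par z = None\<rbrakk> \<Longrightarrow> z \<le> a \<or> b \<le> z"
    and "\<lbrakk>chord_between par (2 * H + 3) a b; chord_between par (2 * H + 3) c d\<rbrakk> \<Longrightarrow>
      \<not> (a < c \<and> c < b \<and> b < d)"
  using assms unfolding plane_parent_def by - (elim conjE, metis)+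

section \<open>Plane spanning trees of the wheel from parent functions\<close>

context wheel
begin

definition vert :: "int \<Rightarrow> int option \<Rightarrow> complex" where
  "vert s z = (case z of None \<Rightarrow> v0 | Some x \<Rightarrow> P (s + x))"

lemma vert_simps [simp]: "vert s None = v0" "vert s (Some x) = P (s + x)"
  by (simp_all add: vert_def)

definition parent_edges :: "int \<Rightarrow> (int \<Rightarrow> int option) \<Rightarrow> complex set set" where
  "parent_edges s par = (\<lambda>x. {P (s + x), vert s (par x)}) ` {0..<N}"

lemma V_eq: "vert s ` (insert None (Some ` {0..<N})) = V"
proof -
  have "P ` {s..<s + N} = range P"
  proof
    show "range P \<subseteq> P ` {s..<s + N}"
    proof
      fix v assume "v \<in> range P"
      then obtain r where "v = P r" by auto
      moreover obtain t where "s \<le> t" "t < s + N" "P t = P r" using P_window[of s r] by blast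
      ultimately show "v \<in> P ` {s..<s + N}" by (intro image_eqI[of _ _ t]) auto
    qed
  qed auto
  moreover have "P ` {s..<s + N} = (\<lambda>x. P (s + x)) ` {0..<N}"
  proof -
    have "{s..<s + N} = (\<lambda>x. s + x) ` {0..<N}" by (simp add: image_add_atLeastLessThan add.commute)
    then show ?thesis by (simp only: image_image)
  qed
  ultimately show ?thesis by (simp add: V_def image_image)
qed

lemma inj_vert: "inj_on (vert s) (insert None (Some ` {0..<N}))"
proof -
  have "x = y" if "0 \<le> x" "x < N" "0 \<le> y" "y < N" "P (s + x) = P (s + y)" for x y
    using that P_inj_window[of "s + x" "s + y"] P_inj_window[of "s + y" "s + x"] by (cases x y rule: linorder_cases) auto
  then show ?thesis using P_neq P_neq[symmetric] by (auto simp: inj_on_def)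
qed

lemma card_V: "card V = nat N + 1"
  using card_image[OF inj_vert[of 0]] unfolding V_eq by (simp add: card_image image_iff)

lemma finite_V: "finite V"
  using V_eq[of 0] by (metis finite.insertI finite_atLeastLessThan_int finite_imageI)

lemma parent_tree:
  assumes plane: "plane_parent H par" and ranked: "ranked_parent H par" and l3: "l = 3"
  shows "tree (V, parent_edges s par)" and "card (parent_edges s par) = nat N"
proof -
  have N: "N = 2 * H + 3" using N_def l3 by simp
  let ?X = "insert None (Some ` {0..<N})"
  let ?par = "\<lambda>z. Option.bind z par"
  obtain rank :: "int \<Rightarrow> nat" where rank: "\<And>x y. \<lbrakk>0 \<le> x; x < N; par x = Some y\<rbrakk> \<Longrightarrow> rank y < rank x"
    using ranked unfolding ranked_parent_def N by blast
  define rk where "rk z = (case z of None \<Rightarrow> 0 | Some x \<Rightarrow> Suc (rank x))" for z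
  have par: "?par z \<in> ?X \<and> rk (?par z) < rk z" if z: "z \<in> ?X" "z \<noteq> None" for z
  proof -
    obtain x where x: "z = Some x" "0 \<le> x" "x < N" using z by auto
    show ?thesis
    proof (cases "par x")
      case (Some y)
      have "0 \<le> y \<and> y < N" using plane_parentD(1)[OF plane x(2) _ Some] x(3) N by linarith
      moreover have "rank y < rank x" by (rule rank[OF x(2,3) Some])
      moreover have "?par z = Some y" using x(1) Some by simp
      ultimately show ?thesis using x(1) by (simp add: rk_def)
    qed (simp add: rk_def x(1))
  qed
  have eq: "(\<lambda>z. {vert s z, vert s (?par z)}) ` (?X - {None}) = parent_edges s par"
  proof -
    have "?X - {None} = Some ` {0..<N}" by auto
    then show ?thesis by (simp add: parent_edges_def image_image)
  qed
  show "tree (V, parent_edges s par)"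
    using tree_of_parents(1)[OF inj_vert[of s] insertI1 par] unfolding V_eq eq .
  have "?X - {None} = Some ` {0..<N}" by auto
  then show "card (parent_edges s par) = nat N"
    using tree_of_parents(2)[OF inj_vert[of s] insertI1 par] unfolding eq by (simp add: card_image)
qed

lemma nested_no_cross:
  assumes "p \<le> r" "r < s" "s \<le> q" "q < p + N"
  shows "\<not> edges_cross {P p, P q} {P r, P s}"
  using chords_no_cross[of r s q "p + N"] assms
  by (simp add: insert_commute edges_cross_commute)

lemma parent_edges_cases:
  assumes "plane_parent H par" "l = 3" "e \<in> parent_edges s par"
  obtains (chord) a b where "chord_between par N a b" "e = {P (s + a), P (s + b)}"
    | (radial) z where "0 \<le> z" "z < N" "par z = None" "e = {v0, P (s + z)}"
proof -
  obtain x where x: "0 \<le> x" "x < N" "e = {P (s + x), vert s (par x)}"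
    using assms(3) by (auto simp: parent_edges_def)
  show thesis
  proof (cases "par x")
    case None
    then show thesis using radial[of x] x by (simp add: insert_commute)
  next
    case (Some y)
    then have y: "0 \<le> y" "y < N" "x \<noteq> y"
      using plane_parentD(1)[OF assms(1) _ _ Some] assms(2) x N_def by auto
    show thesis
    proof (cases "x < y")
      case True then show thesis using chord[of x y] x y Some by (simp add: chord_between_def)
    next
      case False then show thesis using chord[of y x] x y Some
        by (simp add: chord_between_def insert_commute)
    qed
  qed
qed

lemma parent_plane:
  assumes plane: "plane_parent H par" and l3: "l = 3" and s: "s = 3 * g"
  shows "plane_graph (V, parent_edges s par)"
proof -
  have N: "N = 2 * H + 3" using N_def l3 by simp
  have H: "H = 3 * h" using H_def l3 by simp
  have between: "0 \<le> a \<and> a < b \<and> b < N" if "chord_between par N a b" for a b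
    using that by (simp add: chord_between_def)
  have short: "(s + b) div l \<le> (s + a) div l + h" if "chord_between par N a b" for a b
  proof -
    have "b \<le> a + H \<or> a = 0 \<and> b \<le> H + 2 \<or> (a = H \<or> a = H + 1) \<and> b \<le> 2 * H + 2"
      using plane_parentD(2)[OF plane] that unfolding N by blast
    then have "b div 3 \<le> a div 3 + h" unfolding H by presburger
    moreover have "(s + x) div l = g + x div 3" for x using l3 s by simp
    ultimately show ?thesis by simp
  qed
  have cc: "\<not> edges_cross {P (s + a), P (s + b)} {P (s + c), P (s + d)}"
    if *: "chord_between par N a b" "chord_between par N c d" "a \<le> c" for a b c d
  proof -
    have "\<not> (a < c \<and> c < b \<and> b < d)" using plane_parentD(4)[OF plane] *(1,2) unfolding N by blast
    then consider "b \<le> c" | "d \<le> b" | "a = c" "b < d" using *(3) by linarith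
    then show ?thesis
    proof cases
      case 1 then show ?thesis using between[OF *(1)] between[OF *(2)] by (intro chords_no_cross) auto
    next
      case 2 then show ?thesis using between[OF *(1)] between[OF *(2)] *(3) by (intro nested_no_cross) auto
    next
      case 3
      then have "\<not> edges_cross {P (s + c), P (s + d)} {P (s + a), P (s + b)}"
        using between[OF *(1)] between[OF *(2)] by (intro nested_no_cross) auto
      then show ?thesis by (simp add: edges_cross_commute)
    qed
  qed
  have cr: "\<not> edges_cross {v0, P (s + z)} {P (s + a), P (s + b)}"
    if *: "chord_between par N a b" "par z = None" "0 \<le> z" "z < N" for a b z
  proof -
    have "z \<le> a \<or> b \<le> z" using plane_parentD(3)[OF plane] *(1,2) unfolding N by blast
    then show ?thesis
    proof
      assume "b \<le> z"
      then show ?thesis using between[OF *(1)] short[OF *(1)] * by (intro radial_no_cross) auto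
    next
      assume "z \<le> a"
      \<comment> \<open>\<open>radial_no_cross\<close> expects the radial end after the chord, so
        \<open>z\<close> is moved one turn ahead.\<close>
      then have "\<not> edges_cross {v0, P (s + z + N)} {P (s + a), P (s + b)}"
        using between[OF *(1)] short[OF *(1)] * by (intro radial_no_cross) auto
      then show ?thesis by simp
    qed
  qed
  show ?thesis unfolding plane_graph_def snd_conv
  proof (intro ballI)
    fix e f assume e: "e \<in> parent_edges s par" and f: "f \<in> parent_edges s par"
    show "\<not> edges_cross e f"
    proof (cases rule: parent_edges_cases[OF plane l3 e]; cases rule: parent_edges_cases[OF plane l3 f])
      fix a b c d assume "chord_between par N a b" "e = {P (s + a), P (s + b)}"
        "chord_between par N c d" "f = {P (s + c), P (s + d)}"
      then show ?thesis using cc[of a b c d] cc[of c d a b] edges_cross_commute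
        by (cases "a \<le> c") auto
    qed (use cr radials_no_cross edges_cross_commute in auto)
  qed
qed

text \<open>Index \<open>2 * h + 1\<close> is \<open>T0\<close>, with radial edges to the last point
  of group \<open>h\<close> and to all later groups. The index ranges from \<open>- h\<close> to
  \<open>0\<close>, from \<open>1\<close> to \<open>h\<close> and from \<open>h + 1\<close> to
  \<open>2 * h\<close> take the middle, first and last points of the remaining groups; index
  \<open>0\<close> takes the first point of group \<open>0\<close> as well. These are
  \<open>3 * h + 2 = n\<close> trees, and apart from index \<open>0\<close> each family consists of
  rotated copies.\<close>

definition tree_parent :: "int \<Rightarrow> int \<Rightarrow> int option" where
  "tree_parent i = (if i = 2 * h + 1 then star_parent H else if i < 0 then middle_parent H (Some (H + 1))
    else if i = 0 then middle_parent H None else if i \<le> h then first_parent H else last_parent H)"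

definition tree_base :: "int \<Rightarrow> int" where
  "tree_base i = (if i = 2 * h + 1 then 0 else if i \<le> h then i else i - h)"

definition "tree_edges i = parent_edges (3 * tree_base i) (tree_parent i)"

lemma tree_edgesI:
  assumes "tree_parent i x = Some y" "0 \<le> x" "x < N" "a = 3 * tree_base i + x + c * N" "b = 3 * tree_base i + y + c * N"
  shows "{P a, P b} \<in> tree_edges i" "{P b, P a} \<in> tree_edges i"
proof -
  have "{P (3 * tree_base i + x), P (3 * tree_base i + y)} \<in> tree_edges i"
    unfolding tree_edges_def parent_edges_def using assms(1-3) by (intro image_eqI[of _ _ x]) auto
  moreover have "P a = P (3 * tree_base i + x)" "P b = P (3 * tree_base i + y)"
    using assms P_mult by simp_all
  ultimately show "{P a, P b} \<in> tree_edges i" "{P b, P a} \<in> tree_edges i"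
    by (simp_all add: insert_commute)
qed

lemma tree_edges_radialI:
  assumes "tree_parent i x = None" "0 \<le> x" "x < N" "a = 3 * tree_base i + x + c * N"
  shows "{v0, P a} \<in> tree_edges i"
proof -
  have "{P (3 * tree_base i + x), v0} \<in> tree_edges i"
    unfolding tree_edges_def parent_edges_def using assms(1-3) by (intro image_eqI[of _ _ x]) auto
  moreover have "P a = P (3 * tree_base i + x)" using assms P_mult by simp
  ultimately show ?thesis by (simp add: insert_commute)
qed

lemma radial_covered:
  assumes l3: "l = 3"
  shows "\<exists>i\<in>{-h..2 * h + 1}. {v0, P r} \<in> tree_edges i"
proof -
  have N: "N = 2 * H + 3" using N_def l3 by simp
  have H: "H = 3 * h" using H_def l3 by simp
  note defs = tree_parent_def tree_base_def star_parent_def middle_parent_def first_parent_def last_parent_def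
  \<comment> \<open>In this window the groups \<open>h + 1\<close> to \<open>2 * h\<close>, all
    served by \<open>T0\<close>, have negative indices.\<close>
  have main: "\<exists>i\<in>{-h..2 * h + 1}. {v0, P r} \<in> tree_edges i" if r: "- H \<le> r" "r < H + 3" for r
  proof -
    define g where "g = r div 3"
    consider "r < 0" | "0 \<le> r" "r = 3 * g" | "0 \<le> r" "r = 3 * g + 1" | "0 \<le> r" "r = 3 * g + 2"
      unfolding g_def by linarith
    then show ?thesis
    proof cases
      case 1
      have "{v0, P r} \<in> tree_edges (2 * h + 1)"
        by (rule tree_edges_radialI[of _ "r + N" _ "-1"]; (unfold defs)?; use 1 r N h_pos in auto)
      then show ?thesis using h_pos by auto
    next
      case 2
      then have g: "0 \<le> g" "g \<le> h" using r H by auto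
      have "{v0, P r} \<in> tree_edges g"
        by (rule tree_edges_radialI[of _ 0 _ 0]; (unfold defs)?; use 2 g N H h_pos in auto)
      then show ?thesis using g h_pos by auto
    next
      case 3
      then have g: "0 \<le> g" "g \<le> h" using r H by auto
      have "{v0, P r} \<in> tree_edges (g - h)"
        by (rule tree_edges_radialI[of _ "H + 1" _ 0]; (unfold defs)?; use 3 g N H h_pos in auto)
      then show ?thesis using g h_pos by auto
    next
      case 4
      then have g: "0 \<le> g" "g \<le> h" using r H by auto
      show ?thesis
      proof (cases "g = h")
        case True
        have "{v0, P r} \<in> tree_edges (2 * h + 1)"
          by (rule tree_edges_radialI[of _ "H + 2" _ 0]; (unfold defs)?; use 4 True N H h_pos in auto)
        then show ?thesis using h_pos by auto
      next
        case False
        have "{v0, P r} \<in> tree_edges (g + 1 + h)"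
          by (rule tree_edges_radialI[of _ "2 * H + 2" _ "-1"]; (unfold defs)?; use 4 False g N H h_pos in auto)
        then show ?thesis using g False h_pos by auto
      qed
    qed
  qed
  obtain t where "- H \<le> t" "t < - H + N" "P t = P r" using P_window[of "-H" r] by auto
  then show ?thesis using main[of t] N by auto
qed

lemma chord_covered:
  assumes l3: "l = 3" and pq: "p < q" "q div l \<le> p div l + h" and q: "0 \<le> q" "q < N"
  shows "\<exists>i\<in>{-h..2 * h + 1}. {P p, P q} \<in> tree_edges i"
proof -
  have N: "N = 2 * H + 3" using N_def l3 by simp
  have H: "H = 3 * h" using H_def l3 by simp
  note defs = tree_parent_def tree_base_def star_parent_def middle_parent_def first_parent_def last_parent_def
  \<comment> \<open>The earliest group from which a short arc reaches \<open>q\<close>. Relative to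
    \<open>3 * g\<close> the point \<open>q\<close> is \<open>H\<close>, \<open>H + 1\<close> or
    \<open>H + 2\<close>, and the cases look for a fan with apex \<open>q\<close> that contains
    \<open>p\<close>.\<close>
  define g where "g = q div 3 - h"
  have p3: "3 * g \<le> p" using pq(2) le_div_iff[of g p] l3 unfolding g_def by (simp add: mult.commute)
  have g: "- h \<le> g" "g \<le> h" using q N H unfolding g_def by auto
  note facts = p3 g pq(1) q N H h_pos
  consider (0) "q = 3 * g + H" | (1) "q = 3 * g + H + 1" | (2) "q = 3 * g + H + 2"
  proof -
    have "q = 3 * (g + h) + q mod 3" by (simp add: g_def)
    moreover have "q mod 3 = 0 \<or> q mod 3 = 1 \<or> q mod 3 = 2" by presburger
    ultimately show ?thesis using that H by (elim disjE) simp_all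
  qed
  then show ?thesis
  proof cases
    case 0
    consider "g > 0" | "g \<le> 0" "p = 3 * g" | "g \<le> 0" "p > 3 * g" using p3 by linarith
    then show ?thesis
    proof cases
      case 1
      have "{P p, P q} \<in> tree_edges (g + h)"
        by (rule tree_edgesI(1)[of _ "p - 3 * g" H _ 0]; (unfold defs)?; use 0 1 facts in auto)
      then show ?thesis using g 1 h_pos by auto
    next
      case 2
      have "{P p, P q} \<in> tree_edges g"
        by (rule tree_edgesI(2)[of _ H 0 _ 0]; (unfold defs)?; use 0 2 facts in auto)
      then show ?thesis using g h_pos by auto
    next
      case 3
      have "{P p, P q} \<in> tree_edges g"
        by (rule tree_edgesI(1)[of _ "p - 3 * g" H _ 0]; (unfold defs)?; use 0 3 facts in auto)
      then show ?thesis using g h_pos by auto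
    qed
  next
    case 1
    consider "g > 0" | "g = 0" | "g < 0" "p = 3 * g" | "g < 0" "p = 3 * g + 1" | "g < 0" "p > 3 * g + 1"
      using p3 by linarith
    then show ?thesis
    proof cases
      case pos: 1
      show ?thesis
      proof (cases "p = 3 * g")
        case True
        have "{P p, P q} \<in> tree_edges g"
          by (rule tree_edgesI(2)[of _ "H + 1" 0 _ 0]; (unfold defs)?; use 1 pos True facts in auto)
        then show ?thesis using g h_pos by auto
      next
        case False
        have "{P p, P q} \<in> tree_edges g"
          by (rule tree_edgesI(1)[of _ "p - 3 * g" "H + 1" _ 0]; (unfold defs)?; use 1 pos False facts in auto)
        then show ?thesis using g h_pos by auto
      qed
    next
      case 2
      show ?thesis
      proof (cases "p = 0")
        case True
        have "{P p, P q} \<in> tree_edges (2 * h + 1)"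
          by (rule tree_edgesI(2)[of _ "H + 1" 0 _ 0]; (unfold defs)?; use 1 2 True facts in auto)
        then show ?thesis using h_pos by auto
      next
        case False
        have "{P p, P q} \<in> tree_edges (2 * h + 1)"
          by (rule tree_edgesI(1)[of _ p "H + 1" _ 0]; (unfold defs)?; use 1 2 False facts in auto)
        then show ?thesis using h_pos by auto
      qed
    next
      case 3
      have "{P p, P q} \<in> tree_edges g"
        by (rule tree_edgesI(1)[of _ 0 "H + 1" _ 0]; (unfold defs)?; use 1 3 facts in auto)
      then show ?thesis using g h_pos by auto
    next
      case 4
      \<comment> \<open>The base of this tree is group \<open>g + h + 1\<close>, and one turn back
        \<open>3 * (g + h + 1) - N = 3 * g - H\<close>: the chord lies in the second half of the
        tree.\<close>
      have "{P p, P q} \<in> tree_edges (g + h + 1 + h)"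
        by (rule tree_edgesI(2)[of _ "2 * H + 1" "H + 1" _ "-1"]; (unfold defs)?; use 1 4 facts in auto)
      then show ?thesis using g 4 h_pos by auto
    next
      case 5
      have "{P p, P q} \<in> tree_edges (g + h + 1 + h)"
        by (rule tree_edgesI(1)[of _ "p - 3 * g + H" "2 * H + 1" _ "-1"]; (unfold defs)?; use 1 5 facts in auto)
      then show ?thesis using g 5 h_pos by auto
    qed
  next
    case 2
    consider "g > 0" "p = 3 * g" | "g = 0" "p = 3 * g" | "g \<ge> 0" "p = 3 * g + 1" | "g \<ge> 0" "p > 3 * g + 1"
      | "g < 0" "p \<le> 3 * g + 1" | "g < 0" "p = 3 * g + 2" | "g < 0" "p > 3 * g + 2"
      using p3 by linarith
    then show ?thesis
    proof cases
      case 1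
      have "{P p, P q} \<in> tree_edges g"
        by (rule tree_edgesI(2)[of _ "H + 2" 0 _ 0]; (unfold defs)?; use 2 1 facts in auto)
      then show ?thesis using g h_pos by auto
    next
      case zero: 2
      have "{P p, P q} \<in> tree_edges (2 * h + 1)"
        by (rule tree_edgesI(1)[of _ 0 "H + 2" _ 0]; (unfold defs)?; use 2 zero facts in auto)
      then show ?thesis using h_pos by auto
    next
      case 3
      have "{P p, P q} \<in> tree_edges (g - h)"
        by (rule tree_edgesI(2)[of _ "2 * H + 2" "H + 1" _ 0]; (unfold defs)?; use 2 3 facts in auto)
      then show ?thesis using g 3 h_pos by auto
    next
      case 4
      have "{P p, P q} \<in> tree_edges (g - h)"
        by (rule tree_edgesI(1)[of _ "p - 3 * g + H" "2 * H + 2" _ 0]; (unfold defs)?; use 2 4 facts in auto)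
      then show ?thesis using g 4 h_pos by auto
    next
      case 5
      have "{P p, P q} \<in> tree_edges (g + h + 1 + h)"
        by (rule tree_edgesI(1)[of _ "p - 3 * g + H" "2 * H + 2" _ "-1"]; (unfold defs)?; use 2 5 facts in auto)
      then show ?thesis using g 5 h_pos by auto
    next
      case 6
      have "{P p, P q} \<in> tree_edges (g + h + 1)"
        by (rule tree_edgesI(2)[of _ "2 * H + 2" "H + 2" _ "-1"]; (unfold defs)?; use 2 6 facts in auto)
      then show ?thesis using g 6 h_pos by auto
    next
      case 7
      have "{P p, P q} \<in> tree_edges (g + h + 1)"
        by (rule tree_edgesI(1)[of _ "p - 3 * g + H" "2 * H + 2" _ "-1"]; (unfold defs)?; use 2 7 facts in auto)
      then show ?thesis using g 7 h_pos by auto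
    qed
  qed
qed

lemma edge_covered:
  assumes l3: "l = 3" and e: "e \<subseteq> V" "card e = 2"
  shows "\<exists>i\<in>{-h..2 * h + 1}. e \<in> tree_edges i"
proof -
  obtain a b where ab: "e = {a, b}" "a \<noteq> b" using e(2) by (meson card_2_iff)
  have chord: "\<exists>i\<in>{-h..2 * h + 1}. {P p, P q} \<in> tree_edges i" if "P p \<noteq> P q" for p q
  proof -
    obtain q' where q': "0 \<le> q'" "q' < N" "P q' = P q" using P_window[of 0 q] by auto
    obtain p' where p': "q' - N \<le> p'" "p' < q'" "P p' = P p" using P_window[of "q' - N" p] by auto
    have ne: "p' \<noteq> q' - N" using p' q' that P_add_N[of "q' - N"] by auto
    from short_or[of q' p'] p' consider "q' div l \<le> p' div l + h" | "(p' + N) div l \<le> q' div l + h" by force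
    then show ?thesis
    proof cases
      case 1 then show ?thesis using chord_covered[OF l3 p'(2) 1 q'(1,2)] p' q' by simp
    next
      case 2
      show ?thesis
      proof (cases "p' + N < N")
        case True
        then show ?thesis
          using chord_covered[OF l3 _ 2] ne p' q' by (auto simp: insert_commute)
      next
        case False
        have "p' div l \<le> (q' - N) div l + h"
          using 2 div_add_N[of p' 1] div_add_N[of q' "-1"] by simp
        then show ?thesis
          using chord_covered[OF l3, of "q' - N" p'] P_add_N[of "q' - N"] ne p' q' False
          by (auto simp: insert_commute)
      qed
    qed
  qed
  have "a \<in> V" "b \<in> V" using ab e by auto
  then consider p q where "a = P p" "b = P q" | r where "a = v0" "b = P r" | r where "a = P r" "b = v0"
    using ab(2) by (auto simp: V_def)
  then show ?thesis
    using chord radial_covered[OF l3] ab by cases (auto simp: insert_commute)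
qed

lemma partition_if_l_eq_3:
  assumes l3: "l = 3"
  shows "\<exists>\<T>. graph_partition (complete_graph V) \<T> \<and> 2 * int (card \<T>) = N + 1 \<and>
    (\<forall>T\<in>\<T>. spanning_tree T (complete_graph V) \<and> plane_graph T)"
proof -
  have N: "N = 2 * H + 3" using N_def l3 by simp
  have H: "H = 3 * h" using H_def l3 by simp
  then have H3: "H \<ge> 3" using h_pos by simp
  let ?I = "{-h..2 * h + 1}"
  define tr where "tr i = (V, tree_edges i)" for i
  have pl: "plane_parent H (tree_parent i)" for i
    using H3 by (auto simp: tree_parent_def plane_star plane_middle plane_first plane_last)
  have rk: "ranked_parent H (tree_parent i)" for i
    using H3 by (auto simp: tree_parent_def ranked_star ranked_middle ranked_first ranked_last)
  have tree: "tree (tr i)" and cardE: "card (tree_edges i) = nat N" and plane: "plane_graph (tr i)" for i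
    unfolding tr_def tree_edges_def using parent_tree[OF pl rk l3] parent_plane[OF pl l3 refl] by auto
  have fin: "finite (tree_edges i)" for i
    unfolding tree_edges_def parent_edges_def by simp
  let ?K = "{e. e \<subseteq> V \<and> card e = 2}"
  have sub: "tree_edges i \<subseteq> ?K" for i
    using tree[of i] by (simp add: tree_def simple_graph_def tr_def)
  have union: "(\<Union>i\<in>?I. tree_edges i) = ?K"
  proof
    show "(\<Union>i\<in>?I. tree_edges i) \<subseteq> ?K" by (rule UN_least) (rule sub)
    show "?K \<subseteq> (\<Union>i\<in>?I. tree_edges i)"
    proof
      fix e assume "e \<in> ?K"
      then obtain i where "i \<in> ?I" "e \<in> tree_edges i" using edge_covered[OF l3, of e] by auto
      then show "e \<in> (\<Union>i\<in>?I. tree_edges i)" by (rule UN_I)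
    qed
  qed
  have "card ?K = (nat N + 1) choose 2"
    using n_subsets[OF finite_V, of 2] card_V by simp
  also have "\<dots> = (nat N + 1) * nat N div 2" by (simp add: choose_two)
  also have "\<dots> = card ?I * nat N"
  proof -
    have "nat N + 1 = 2 * card ?I" using N H h_pos by simp
    then show ?thesis by simp
  qed
  finally have "(\<Sum>i\<in>?I. card (tree_edges i)) = card (\<Union>i\<in>?I. tree_edges i)"
    using union by (simp add: cardE)
  then have disj: "tree_edges i \<inter> tree_edges j = {}" if "i \<in> ?I" "j \<in> ?I" "i \<noteq> j" for i j
    using disjoint_if_sum_card_le[of ?I tree_edges i j] fin that by simp
  have ne: "tree_edges i \<noteq> {}" for i using cardE[of i] N_pos by auto
  \<comment> \<open>Disjoint nonempty edge sets make the trees distinct, so the set of trees really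
    has \<open>n\<close> elements.\<close>
  have inj: "inj_on tr ?I"
    using disj ne by (auto simp: inj_on_def tr_def) blast
  have spanning: "spanning_tree (tr i) (complete_graph V)" for i
    using tree[of i] sub[of i]
    by (simp add: spanning_tree_def subgraph_def complete_graph_def tree_def tr_def)
  have "graph_partition (complete_graph V) (tr ` ?I)"
    unfolding graph_partition_def
  proof (intro conjI ballI impI)
    show "subgraph T (complete_graph V)" if "T \<in> tr ` ?I" for T
      using that spanning by (auto simp: spanning_tree_def)
    show "edges T \<inter> edges T' = {}" if "T \<in> tr ` ?I" "T' \<in> tr ` ?I" "T \<noteq> T'" for T T'
    proof -
      obtain i j where ij: "i \<in> ?I" "j \<in> ?I" "T = tr i" "T' = tr j" using \<open>T \<in> tr ` ?I\<close> \<open>T' \<in> tr ` ?I\<close> by auto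
      then have "i \<noteq> j" using \<open>T \<noteq> T'\<close> by auto
      then show ?thesis using disj[OF ij(1,2)] ij(3,4) by (simp add: tr_def)
    qed
    show "\<Union> (verts ` tr ` ?I) = verts (complete_graph V)"
      using h_pos by (auto simp: tr_def complete_graph_def)
    show "\<Union> (edges ` tr ` ?I) = edges (complete_graph V)"
      using union by (simp add: tr_def complete_graph_def image_image)
  qed
  moreover have "2 * int (card (tr ` ?I)) = N + 1"
    using card_image[OF inj] N H h_pos by simp
  ultimately show ?thesis using spanning plane by blast
qed

end

section \<open>Geometry of bumpy wheels\<close>

text \<open>Twice the signed area of the triangle, positive in counterclockwise order.\<close>

definition orient :: "complex \<Rightarrow> complex \<Rightarrow> complex \<Rightarrow> real" where
  "orient a b c = (Re b - Re a) * (Im c - Im a) - (Im b - Im a) * (Re c - Re a)"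

lemma orient_degenerate [simp]: "orient a a b = 0" "orient a b a = 0" "orient a b b = 0"
  by (simp_all add: orient_def)

lemma orient_rotate: "orient b c a = orient a b c"
  and orient_swap: "orient b a c = - orient a b c"
  by (simp_all add: orient_def algebra_simps)

lemma orient_sum: "orient a b c = orient z a b + orient z b c - orient z a c"
  by (simp add: orient_def algebra_simps)

lemma orient_affine:
  "orient a b ((1 - u) *\<^sub>R c + u *\<^sub>R d) = (1 - u) * orient a b c + u * orient a b d"
  by (simp add: orient_def algebra_simps)

lemma orient_polar:
  "orient z (z + of_real r * cis s) (z + of_real r' * cis t) = r * r' * sin (t - s)"
  by (simp add: orient_def sin_diff algebra_simps)

lemma edges_cross_iff:
  assumes "a \<noteq> b" "c \<noteq> d"
  shows "edges_cross {a, b} {c, d} \<longleftrightarrow>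
    {a, b} \<noteq> {c, d} \<and> open_segment a b \<inter> open_segment c d \<noteq> {}"
  using assms by (simp add: edges_cross_def segment_convex_hull[symmetric] rel_interior_closed_segment)

lemma open_segments_meet:
  assumes "orient a b c > 0" "orient a b d < 0" "orient c d a < 0" "orient c d b > 0"
  shows "open_segment a b \<inter> open_segment c d \<noteq> {}"
proof -
  define D where "D = orient a b c - orient a b d"
  have D: "D > 0" using assms by (simp add: D_def)
  have D': "D = orient c d b - orient c d a"
    by (simp add: D_def orient_def algebra_simps)
  \<comment> \<open>\<open>orient a b\<close> is affine along the segment from \<open>c\<close> to
    \<open>d\<close> and vanishes at parameter \<open>t\<close>; likewise \<open>orient c d\<close>
    along the other segment at \<open>s\<close>.\<close>
  define t where "t = orient a b c / D"
  define s where "s = - orient c d a / D"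
  have t: "0 < t" "t < 1" using assms D by (simp_all add: t_def D_def divide_less_eq)
  have "- orient c d a < D" using assms by (simp add: D')
  then have s: "0 < s" "s < 1"
    using assms D unfolding s_def by (auto intro!: divide_pos_pos simp only: divide_less_eq_1_pos neg_0_less_iff_less)
  have "D *\<^sub>R ((1 - t) *\<^sub>R c + t *\<^sub>R d) = D *\<^sub>R ((1 - s) *\<^sub>R a + s *\<^sub>R b)"
  proof -
    have 1: "D * t = orient a b c" "D * s = - orient c d a" using D by (simp_all add: t_def s_def)
    have "D *\<^sub>R ((1 - t) *\<^sub>R c + t *\<^sub>R d) = (D - D * t) *\<^sub>R c + (D * t) *\<^sub>R d"
      by (simp add: algebra_simps)
    also have "\<dots> = (D - D * s) *\<^sub>R a + (D * s) *\<^sub>R b"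
      unfolding 1 unfolding D_def orient_def by (simp add: complex_eq_iff algebra_simps)
    also have "\<dots> = D *\<^sub>R ((1 - s) *\<^sub>R a + s *\<^sub>R b)" by (simp add: algebra_simps)
    finally show ?thesis .
  qed
  then have eq: "(1 - t) *\<^sub>R c + t *\<^sub>R d = (1 - s) *\<^sub>R a + s *\<^sub>R b" using D by simp
  have "a \<noteq> b" "c \<noteq> d" using assms by auto
  then have "(1 - s) *\<^sub>R a + s *\<^sub>R b \<in> open_segment a b" "(1 - t) *\<^sub>R c + t *\<^sub>R d \<in> open_segment c d"
    using s t by (auto simp: in_segment)
  then show ?thesis using eq by auto
qed

text \<open>\<open>orient a b\<close> vanishes on the first segment and is positive on the
  second.\<close>

lemma open_segments_disjoint:
  assumes "orient a b c \<ge> 0" "orient a b d \<ge> 0" "orient a b c > 0 \<or> orient a b d > 0"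
  shows "open_segment a b \<inter> open_segment c d = {}"
proof (rule ccontr)
  assume "\<not> ?thesis"
  then obtain x where x: "x \<in> open_segment a b" "x \<in> open_segment c d" by blast
  obtain u where u: "x = (1 - u) *\<^sub>R a + u *\<^sub>R b"
    using x(1) unfolding in_segment by blast
  obtain v where v: "0 < v" "v < 1" "x = (1 - v) *\<^sub>R c + v *\<^sub>R d"
    using x(2) unfolding in_segment by blast
  have "orient a b x = 0" unfolding u by (simp add: orient_affine)
  moreover have "orient a b x > 0" unfolding v(3) orient_affine using assms v
    by (smt (verit) mult_nonneg_nonneg mult_pos_pos)
  ultimately show False by simp
qed

lemma extreme_point_not_in_triangle:
  assumes "x extreme_point_of (convex hull S)" "{a, b, c} \<subseteq> convex hull S" "x \<in> convex hull {a, b, c}"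
  shows "x \<in> {a, b, c}"
proof -
  have sub: "convex hull {a, b, c} \<subseteq> convex hull S"
    using assms(2) by (simp add: hull_minimal)
  have "x extreme_point_of (convex hull {a, b, c})"
    using assms(1,3) sub unfolding extreme_point_of_def by blast
  then show ?thesis using extreme_point_of_convex_hull by blast
qed

text \<open>\<open>\<theta>\<close> is the angle around the centre lifted to the periodic indices,
  so it increases without wrapping around.\<close>

locale wheel_points = wheel_index +
  fixes P :: "int \<Rightarrow> complex" and v0 :: complex and \<rho> \<theta> :: "int \<Rightarrow> real"
  assumes polar: "P p = v0 + of_real (\<rho> p) * cis (\<theta> p)"
    and \<rho>_pos: "\<rho> p > 0"
    and P_period: "P (p + N) = P p"
    and \<theta>_less: "p < q \<Longrightarrow> \<theta> p < \<theta> q"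
    and \<theta>_short: "q div l \<le> p div l + h \<Longrightarrow> \<theta> q - \<theta> p < pi"
    and extreme: "P p extreme_point_of (convex hull (insert v0 (range P)))"
begin

lemma P_neq: "P p \<noteq> v0"
  using \<rho>_pos[of p] by (simp add: polar)

lemma orient_center: "\<lbrakk>p < q; q div l \<le> p div l + h\<rbrakk> \<Longrightarrow> orient v0 (P p) (P q) > 0"
  unfolding polar orient_polar using \<theta>_less \<theta>_short \<rho>_pos
  by (intro mult_pos_pos sin_gt_zero) auto

text \<open>Otherwise \<open>P q\<close> lies in the triangle of \<open>v0\<close>,
  \<open>P p\<close> and \<open>P r\<close> without being a corner, so it is not extreme.\<close>

lemma orient_short:
  assumes "p < q" "q < r" "r div l \<le> p div l + h"
  shows "orient (P p) (P q) (P r) > 0"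
proof (rule ccontr)
  assume neg: "\<not> ?thesis"
  have mono: "p div l \<le> q div l" "q div l \<le> r div l"
    using assms l_ge by (auto intro: zdiv_mono1)
  define A where "A = orient v0 (P p) (P q)"
  define B where "B = orient v0 (P q) (P r)"
  define C where "C = orient v0 (P p) (P r)"
  have pos: "A > 0" "B > 0" "C > 0"
    unfolding A_def B_def C_def using assms mono by (auto intro!: orient_center)
  have le: "A + B \<le> C" using neg orient_sum[of "P p" "P q" "P r" v0] by (simp add: A_def B_def C_def)
  \<comment> \<open>Barycentric coordinates of \<open>P q\<close>, as areas of the triangles
    opposite the three corners.\<close>
  have "C *\<^sub>R P q = (C - A - B) *\<^sub>R v0 + B *\<^sub>R P p + A *\<^sub>R P r"
    unfolding A_def B_def C_def orient_def by (simp add: complex_eq_iff algebra_simps)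
  then have "(1 / C) *\<^sub>R (C *\<^sub>R P q) = (1 / C) *\<^sub>R ((C - A - B) *\<^sub>R v0 + B *\<^sub>R P p + A *\<^sub>R P r)"
    by simp
  then have "P q = ((C - A - B) / C) *\<^sub>R v0 + (B / C) *\<^sub>R P p + (A / C) *\<^sub>R P r"
    using pos by (simp add: scaleR_add_right)
  moreover have "(C - A - B) / C \<ge> 0" "B / C \<ge> 0" "A / C \<ge> 0" "(C - A - B) / C + B / C + A / C = 1"
    using pos le by (simp_all add: field_simps)
  ultimately have "P q \<in> convex hull {v0, P p, P r}"
    unfolding convex_hull_3 by blast
  moreover have "{v0, P p, P r} \<subseteq> convex hull (insert v0 (range P))"
    using hull_subset[of "insert v0 (range P)" convex] by auto
  ultimately have "P q \<in> {v0, P p, P r}" using extreme_point_not_in_triangle[OF extreme] by blast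
  moreover have "P q \<noteq> P p" using pos(1) by (auto simp: A_def)
  moreover have "P q \<noteq> P r" using pos(2) by (auto simp: B_def)
  ultimately show False using P_neq by auto
qed

text \<open>Either all three sides are short in cyclic direction, and the area is the sum of three
  positive ones with apex \<open>v0\<close>; or the points fit, after rotation, into one short
  range.\<close>

lemma orient_pos:
  assumes "p < q" "q < r" "r < p + N"
  shows "orient (P p) (P q) (P r) > 0"
proof -
  consider "q div l \<le> p div l + h" "r div l \<le> q div l + h" "(p + N) div l \<le> r div l + h"
    | "(p + N) div l \<le> q div l + h" | "(q + N) div l \<le> r div l + h" | "r div l \<le> p div l + h"
    using short_or[of q p] short_or[of r q] short_or[of r p] assms by linarith
  then show ?thesis
  proof cases
    case 1
    have "orient v0 (P p) (P q) > 0" "orient v0 (P q) (P r) > 0"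
      using 1 assms by (auto intro!: orient_center)
    moreover have "orient v0 (P r) (P p) > 0"
      using orient_center[of r "p + N"] 1 assms by (simp only: P_period)
    ultimately show ?thesis by (simp add: orient_def algebra_simps)
  next
    case 2
    have "orient (P q) (P r) (P (p + N)) > 0" using 2 assms by (intro orient_short) auto
    then show ?thesis by (simp add: P_period orient_rotate)
  next
    case 3
    have "orient (P r) (P (p + N)) (P (q + N)) > 0" using 3 assms by (intro orient_short) auto
    then show ?thesis by (simp add: P_period orient_rotate)
  next
    case 4 then show ?thesis using assms by (intro orient_short)
  qed
qed

lemma orient_center_neq:
  assumes "p < q" "q < p + N"
  shows "orient v0 (P p) (P q) \<noteq> 0"
proof -
  from short_or[of q p] assms consider "q div l \<le> p div l + h" | "(p + N) div l \<le> q div l + h" by force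
  then show ?thesis
  proof cases
    case 1 then show ?thesis using orient_center[of p q] assms by simp
  next
    case 2
    then have "orient v0 (P q) (P p) > 0"
      using orient_center[of q "p + N"] assms by (simp only: P_period)
    then show ?thesis by (simp add: orient_def algebra_simps)
  qed
qed

lemma P_neq_window: "\<lbrakk>p < q; q < p + N\<rbrakk> \<Longrightarrow> P p \<noteq> P q"
  using orient_center_neq[of p q] by auto

lemma P_mult: "P (p + c * N) = P p"
  using P_period by (rule periodic_mult)

lemma P_window: "\<exists>t. r \<le> t \<and> t < r + N \<and> P t = P s"
  using P_period by (rule periodic_window)

lemma P_eq_iff: "P p = P q \<longleftrightarrow> N dvd p - q"
proof
  assume "N dvd p - q"
  then obtain c where "p - q = N * c" by (auto elim: dvdE)
  then have "p = q + c * N" by (simp add: algebra_simps)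
  then show "P p = P q" by (simp add: P_mult)
next
  assume eq: "P p = P q"
  have "p = q + (p - q) mod N + (p - q) div N * N" by simp
  then have "P p = P (q + (p - q) mod N)" by (metis P_mult)
  then have "\<not> (q < q + (p - q) mod N \<and> q + (p - q) mod N < q + N)"
    using P_neq_window[of q "q + (p - q) mod N"] eq by auto
  then have "(p - q) mod N = 0" using N_pos pos_mod_sign[of N "p - q"] pos_mod_bound[of N "p - q"] by linarith
  then show "N dvd p - q" by (simp add: dvd_eq_mod_eq_0)
qed

lemma wheel: "wheel h l N H P v0"
proof (intro wheel.intro wheel_axioms.intro wheel_index_axioms P_eq_iff P_neq)
  fix p q r s assume *: "p < q" "q < r" "r < s" "s < p + N"
  have "orient (P p) (P r) (P s) > 0" "orient (P p) (P q) (P r) > 0"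
    "orient (P p) (P q) (P s) > 0" "orient (P q) (P r) (P s) > 0"
    using * by (auto intro!: orient_pos)
  then have "open_segment (P p) (P r) \<inter> open_segment (P s) (P q) \<noteq> {}"
    by (intro open_segments_meet) (simp_all add: orient_def algebra_simps)
  moreover have "P p \<noteq> P r" "P s \<noteq> P q" "P p \<noteq> P q" "P p \<noteq> P s"
    using * P_neq_window[of p r] P_neq_window[of q s] P_neq_window[of p q] P_neq_window[of p s] by auto
  ultimately have "edges_cross {P p, P r} {P s, P q}"
    by (simp add: edges_cross_iff doubleton_eq_iff)
  then show "edges_cross {P p, P r} {P q, P s}" by (simp add: insert_commute)
next
  fix p q r s assume *: "p < q" "q \<le> r" "r < s" "s \<le> p + N"
  show "\<not> edges_cross {P p, P q} {P r, P s}"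
  proof (cases "r = q \<and> s = p + N")
    \<comment> \<open>The two chords are the same edge, which \<open>edges_cross\<close>
      excludes.\<close>
    case True
    then show ?thesis by (simp add: edges_cross_def P_period insert_commute)
  next
    case False
    have r: "orient (P p) (P q) (P r) \<ge> 0" "r \<noteq> q \<Longrightarrow> orient (P p) (P q) (P r) > 0"
      using orient_pos[of p q r] * by (cases "r = q"; simp)+
    have s: "orient (P p) (P q) (P s) \<ge> 0" "s \<noteq> p + N \<Longrightarrow> orient (P p) (P q) (P s) > 0"
      using orient_pos[of p q s] * by (cases "s = p + N"; simp add: P_period)+
    have "open_segment (P p) (P q) \<inter> open_segment (P r) (P s) = {}"
      using r s False by (intro open_segments_disjoint) auto
    moreover have "P p \<noteq> P q" "P r \<noteq> P s"
      using * P_neq_window[of p q] P_neq_window[of r s] by auto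
    ultimately show ?thesis by (simp add: edges_cross_iff)
  qed
next
  fix p q r assume *: "q div l \<le> p div l + h" "p < r" "r < q"
  have mono: "p div l \<le> r div l" "r div l \<le> q div l" using * l_ge by (auto intro: zdiv_mono1)
  have N: "q < p + N" using short_less * by blast
  have "orient v0 (P p) (P r) > 0" "orient v0 (P r) (P q) > 0" "orient v0 (P p) (P q) > 0"
    "orient (P p) (P r) (P q) > 0"
    using * mono N by (auto intro!: orient_center orient_pos)
  then have "open_segment v0 (P r) \<inter> open_segment (P q) (P p) \<noteq> {}"
    by (intro open_segments_meet) (simp_all add: orient_def algebra_simps)
  moreover have "P p \<noteq> P q" using * N P_neq_window[of p q] by simp
  ultimately have "edges_cross {v0, P r} {P q, P p}"
    using P_neq P_neq[symmetric] by (simp add: edges_cross_iff doubleton_eq_iff)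
  then show "edges_cross {v0, P r} {P p, P q}" by (simp add: insert_commute)
next
  fix p q r assume *: "q div l \<le> p div l + h" "p < q" "q \<le> r" "r \<le> p + N"
  have N: "q < p + N" using short_less * by blast
  have "orient (P p) (P q) (P r) \<ge> 0"
    using orient_pos[of p q r] * by (cases "r = q"; cases "r = p + N"; simp add: P_period)
  moreover have "orient (P p) (P q) v0 > 0" using orient_center[of p q] * by (simp add: orient_rotate)
  ultimately have "open_segment (P p) (P q) \<inter> open_segment v0 (P r) = {}"
    by (intro open_segments_disjoint) auto
  moreover have "P p \<noteq> P q" using * N P_neq_window[of p q] by simp
  ultimately show "\<not> edges_cross {v0, P r} {P p, P q}"
    using P_neq P_neq[symmetric] by (simp add: edges_cross_iff Int_commute)
next
  fix r s
  show "\<not> edges_cross {v0, P r} {v0, P s}"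
  proof (cases "P r = P s")
    case True then show ?thesis by (simp add: edges_cross_def)
  next
    case False
    obtain t where t: "r \<le> t" "t < r + N" "P t = P s" using P_window by blast
    then have "orient v0 (P r) (P s) \<noteq> 0" using orient_center_neq[of r t] False by (cases "r = t") auto
    then consider "orient v0 (P r) (P s) > 0" | "orient (P r) v0 (P s) > 0"
      using orient_swap[of v0 "P r" "P s"] by fastforce
    then have "open_segment v0 (P r) \<inter> open_segment v0 (P s) = {}"
    proof cases
      case 1 then show ?thesis by (intro open_segments_disjoint) auto
    next
      case 2
      then have "open_segment (P r) v0 \<inter> open_segment v0 (P s) = {}" by (intro open_segments_disjoint) auto
      then show ?thesis by (simp add: open_segment_commute)
    qed
    then show ?thesis using P_neq P_neq[symmetric] by (simp add: edges_cross_iff)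
  qed
qed

end

section \<open>Indexing the points of a bumpy wheel by angle\<close>

lemma collinear_if_on_line:
  assumes "\<And>x. x \<in> S \<Longrightarrow> \<exists>t::real. x = a + t *\<^sub>R u"
  shows "collinear S"
  unfolding collinear_def
proof (intro exI[of _ u] ballI)
  fix x y assume "x \<in> S" "y \<in> S"
  then obtain s t where "x = a + s *\<^sub>R u" "y = a + t *\<^sub>R u" using assms by meson
  then have "x - y = (s - t) *\<^sub>R u" by (simp add: scaleR_diff_left)
  then show "\<exists>c. x - y = c *\<^sub>R u" by blast
qed

text \<open>Each group is sorted by its angle at \<open>v0\<close>. The assumption
  \<open>small\<close> is the smallness of \<open>\<epsilon>\<close>, stated for the
  \<open>k\<close>-gon rescaled so that a vertex is at \<open>1\<close>.\<close>

lemma bumpy_wheel_points: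
  fixes k l :: nat
  assumes bw: "bumpy_wheel k l v0 w \<epsilon> V" and k: "odd k" "k \<ge> 3" and l: "l \<ge> 3" and w: "w \<noteq> 0"
    and small: "\<And>z. cmod (z - 1) \<le> \<epsilon> / cmod w \<Longrightarrow> \<bar>Arg z\<bar> < pi / (2 * real k)"
  shows "\<exists>P \<rho> \<theta>. wheel_points (int (k div 2)) (int l) (int (k * l)) (int (k div 2 * l)) P v0 \<rho> \<theta> \<and>
    insert v0 (range P) = V"
proof -
  define h where "h = k div 2"
  have kh: "k = 2 * h + 1" using k(1) by (simp add: h_def)
  have h1: "h \<ge> 1" using k kh by simp
  obtain A where bwA: "V = insert v0 (\<Union>i<k. A i) \<and> card V = k * l + 1 \<and>
      (\<forall>i<k. card (A i) = l \<and> (\<forall>x\<in>A i. dist x (kgon_vertex k v0 w i) \<le> \<epsilon>)) \<and>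
      general_position V \<and> (\<forall>x\<in>V - {v0}. x extreme_point_of (convex hull V)) \<and>
      v0 \<in> interior (convex hull V) \<and>
      (\<forall>i<k. v0 \<notin> convex hull (\<Union>m<(k + 1) div 2. A ((i + m) mod k)))"
    using bw unfolding bumpy_wheel_def by (elim exE)
  note A = bwA[THEN conjunct1] bwA[THEN conjunct2, THEN conjunct1]
  note A_card_near = bwA[THEN conjunct2, THEN conjunct2, THEN conjunct1, rule_format]
  note gp = bwA[THEN conjunct2, THEN conjunct2, THEN conjunct2, THEN conjunct1]
  note ext = bwA[THEN conjunct2, THEN conjunct2, THEN conjunct2, THEN conjunct2, THEN conjunct1, rule_format]
  have cardA: "card (A i) = l" if "i < k" for i using A_card_near[OF that] by simp
  have near: "dist x (kgon_vertex k v0 w i) \<le> \<epsilon>" if "i < k" "x \<in> A i" for i x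
    using A_card_near[OF that(1)] that(2) by simp
  have finA: "finite (A i)" if "i < k" for i using cardA[OF that] l by (intro card_ge_0_finite) simp
  define U where "U = (\<Union>i<k. A i)"
  have finU: "finite U" using finA by (auto simp: U_def)
  have "card U \<le> (\<Sum>i<k. card (A i))" unfolding U_def by (intro card_UN_le) simp
  also have "\<dots> = k * l" using cardA by simp
  finally have "card U \<le> k * l" .
  moreover have "card (insert v0 U) = k * l + 1" using A by (simp add: U_def)
  ultimately have v0U: "v0 \<notin> U" and cardU: "card U = k * l"
    using finU by (auto simp: card_insert_if split: if_splits)
  have disj: "A i \<inter> A j = {}" if "i < k" "j < k" "i \<noteq> j" for i j
    using disjoint_if_sum_card_le[of "{..<k}" A i j] finA cardA cardU that by (simp add: U_def)
  have neq_v0: "x \<noteq> v0" if "i < k" "x \<in> A i" for i x using that v0U by (auto simp: U_def)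
  \<comment> \<open>The angular deviation from the direction of the \<open>i\<close>-th vertex; the
    normalization moves this vertex to \<open>1\<close>, away from the cut of
    \<open>Arg\<close>.\<close>
  define \<psi> where "\<psi> i x = Arg ((x - v0) / w * cis (- (2 * pi * real i / real k)))" for i x
  have polar: "x = v0 + of_real (cmod (x - v0)) * cis (Arg w + 2 * pi * real i / real k + \<psi> i x)" for i x
  proof -
    define a where "a = 2 * pi * real i / real k"
    define z where "z = (x - v0) / w * cis (- a)"
    have z: "z = of_real (cmod z) * cis (\<psi> i x)"
      using rcis_cmod_Arg[of z] by (simp add: rcis_def \<psi>_def z_def a_def)
    have w': "w = of_real (cmod w) * cis (Arg w)" using rcis_cmod_Arg[of w] by (simp add: rcis_def)
    have cz: "cmod z = cmod (x - v0) / cmod w" by (simp add: z_def norm_mult norm_divide)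
    have "x - v0 = w * z * cis a" using w by (simp add: z_def cis_mult)
    also have "\<dots> = of_real (cmod w) * cis (Arg w) * (of_real (cmod z) * cis (\<psi> i x)) * cis a"
      using z w' by metis
    also have "\<dots> = of_real (cmod w * cmod z) * cis (Arg w + a + \<psi> i x)"
      by (simp add: cis_mult[symmetric] algebra_simps)
    also have "cmod w * cmod z = cmod (x - v0)" using w cz by simp
    finally show ?thesis by (simp add: a_def algebra_simps)
  qed
  have \<psi>_small: "\<bar>\<psi> i x\<bar> < pi / (2 * real k)" if "i < k" "x \<in> A i" for i x
    unfolding \<psi>_def
  proof (rule small)
    define a where "a = 2 * pi * real i / real k"
    have "(x - v0) / w * cis (- a) - 1 = (x - kgon_vertex k v0 w i) / w * cis (- a)"
      using w by (simp add: kgon_vertex_def a_def field_simps cis_mult)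
    then have "cmod ((x - v0) / w * cis (- a) - 1) = dist x (kgon_vertex k v0 w i) / cmod w"
      by (simp add: norm_mult norm_divide dist_norm)
    also have "\<dots> \<le> \<epsilon> / cmod w" using near[OF that] by (simp add: divide_right_mono)
    finally show "cmod ((x - v0) / w * cis (- (2 * pi * real i / real k)) - 1) \<le> \<epsilon> / cmod w"
      by (simp add: a_def)
  qed
  \<comment> \<open>Two points at the same angle would be collinear with \<open>v0\<close>, against
    general position.\<close>
  have inj: "inj_on (\<psi> i) (A i)" if i: "i < k" for i
  proof
    fix x y assume xy: "x \<in> A i" "y \<in> A i" "\<psi> i x = \<psi> i y"
    let ?u = "cis (Arg w + 2 * pi * real i / real k + \<psi> i x)"
    have "collinear {v0, x, y}"
    proof (rule collinear_if_on_line)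
      fix z assume "z \<in> {v0, x, y}"
      then have "z = v0 + cmod (z - v0) *\<^sub>R ?u"
        using polar[of x i] polar[of y i] xy(3) by (auto simp: scaleR_conv_of_real)
      then show "\<exists>t. z = v0 + t *\<^sub>R ?u" by blast
    qed
    moreover have "x \<in> V" "y \<in> V" "v0 \<in> V" using xy i A(1) by auto
    ultimately show "x = y" using gp neq_v0[OF i] xy(1,2) unfolding general_position_def by metis
  qed
  define sl where "sl i = sorted_list_of_set (\<psi> i ` A i)" for i
  have sl: "set (sl i) = \<psi> i ` A i" "length (sl i) = l" "sorted_wrt (<) (sl i)" if "i < k" for i
    using finA[OF that] cardA[OF that] card_image[OF inj[OF that]] by (simp_all add: sl_def)
  define pt where "pt i a = inv_into (A i) (\<psi> i) (sl i ! a)" for i a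
  have pt: "pt i a \<in> A i" "\<psi> i (pt i a) = sl i ! a" if "i < k" "a < l" for i a
  proof -
    have "sl i ! a \<in> \<psi> i ` A i" using sl[OF that(1)] that(2) nth_mem[of a "sl i"] by simp
    then show "pt i a \<in> A i" "\<psi> i (pt i a) = sl i ! a"
      unfolding pt_def by (rule inv_into_into, rule f_inv_into_f)
  qed
  have pt_surj: "\<exists>a<l. pt i a = x" if ix: "i < k" "x \<in> A i" for i x
  proof -
    have "\<psi> i x \<in> set (sl i)" using sl(1) ix by simp
    then obtain a where "a < l" "sl i ! a = \<psi> i x"
      using sl(2)[OF ix(1)] by (auto simp: in_set_conv_nth)
    then show ?thesis using inv_into_f_f[OF inj[OF ix(1)] ix(2)] by (auto simp: pt_def)
  qed
  define gi where "gi p = nat ((p div int l) mod int k)" for p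
  define ai where "ai p = nat (p mod int l)" for p
  have gi: "gi p < k" and ai: "ai p < l" for p
    using k l by (simp_all add: gi_def ai_def nat_less_iff)
  define P where "P p = pt (gi p) (ai p)" for p
  \<comment> \<open>The group number is not reduced modulo \<open>k\<close>, so every turn adds
    \<open>2 * pi\<close>.\<close>
  define \<theta> where "\<theta> p = Arg w + 2 * pi * real_of_int (p div int l) / real k + sl (gi p) ! ai p" for p
  define \<rho> where "\<rho> p = cmod (P p - v0)" for p
  have PA: "P p \<in> A (gi p)" for p unfolding P_def using pt gi ai by blast
  have sl_small: "\<bar>sl (gi p) ! ai p\<bar> < pi / (2 * real k)" for p
    using \<psi>_small[OF gi[of p] PA[of p]] pt(2)[OF gi ai] by (simp add: P_def)
  have rangeP: "range P = U"
  proof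
    show "range P \<subseteq> U" using PA gi by (auto simp: U_def)
    show "U \<subseteq> range P"
    proof
      fix x assume "x \<in> U"
      then obtain i where i: "i < k" "x \<in> A i" by (auto simp: U_def)
      then obtain a where a: "a < l" "pt i a = x" using pt_surj by blast
      have "(int i * int l + int a) div int l = int i" "(int i * int l + int a) mod int l = int a"
        using a l by simp_all
      then have "P (int i * int l + int a) = x" using a i by (simp add: P_def gi_def ai_def)
      then show "x \<in> range P" by blast
    qed
  qed
  have V: "insert v0 (range P) = V" using A(1) rangeP by (simp add: U_def)
  have "wheel_points (int h) (int l) (int (k * l)) (int (h * l)) P v0 \<rho> \<theta>"
  proof
    show "1 \<le> int h" "3 \<le> int l" "int (h * l) = int h * int l" using h1 l by simp_all
    show "int (k * l) = 2 * int (h * l) + int l" by (simp add: kh algebra_simps)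
  next
    fix p
    have gp: "p div int l = int (gi p) + int k * (p div int l div int k)"
      using k by (simp add: gi_def)
    have "real_of_int (p div int l) = real (gi p) + real k * real_of_int (p div int l div int k)"
      by (subst gp) simp
    then have "\<theta> p = (Arg w + 2 * pi * real (gi p) / real k + sl (gi p) ! ai p)
        + 2 * pi * real_of_int (p div int l div int k)"
      using k unfolding \<theta>_def by (simp add: field_simps)
    then have "cis (\<theta> p) = cis (Arg w + 2 * pi * real (gi p) / real k + sl (gi p) ! ai p)"
      by (simp add: cis_mult[symmetric])
    then show "P p = v0 + of_real (\<rho> p) * cis (\<theta> p)"
      using polar[of "P p" "gi p"] pt(2)[OF gi ai] by (simp add: P_def \<rho>_def)
    show "\<rho> p > 0" using neq_v0[OF gi PA] by (simp add: \<rho>_def)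
    show "P (p + int (k * l)) = P p"
      using l by (simp add: P_def gi_def ai_def)
    show "P p extreme_point_of (convex hull (insert v0 (range P)))"
    proof -
      have "P p \<in> U" using rangeP by blast
      then have "P p \<in> V - {v0}" using V rangeP v0U by auto
      then show ?thesis unfolding V by (rule ext)
    qed
  next
    fix p q :: int assume pq: "p < q"
    have le: "p div int l \<le> q div int l" using pq l by (intro zdiv_mono1) auto
    show "\<theta> p < \<theta> q"
    proof (cases "p div int l = q div int l")
      case True
      then have "p mod int l < q mod int l"
      proof -
        have "p = int l * (q div int l) + p mod int l" "q = int l * (q div int l) + q mod int l"
          using True mult_div_mod_eq[of "int l" p] by simp_all
        then show ?thesis using pq by linarith
      qed
      moreover have "p mod int l \<ge> 0" "q mod int l \<ge> 0" using l by simp_all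
      ultimately have "ai p < ai q" by (simp add: ai_def)
      moreover have "gi p = gi q" using True by (simp add: gi_def)
      ultimately show ?thesis
        using sorted_wrt_nth_less[OF sl(3)[OF gi], of "ai p" "ai q" p] sl(2)[OF gi] ai True
        by (simp add: \<theta>_def)
    next
      case False
      then have "real_of_int (p div int l) + 1 \<le> real_of_int (q div int l)" using le by linarith
      then have "2 * pi / real k * (real_of_int (p div int l) + 1) \<le> 2 * pi / real k * real_of_int (q div int l)"
        using k by (intro mult_left_mono) auto
      then have "2 * pi * real_of_int (p div int l) / real k + 2 * pi / real k
          \<le> 2 * pi * real_of_int (q div int l) / real k"
        by (simp add: algebra_simps add_divide_distrib)
      moreover have "pi / (2 * real k) + pi / (2 * real k) \<le> 2 * pi / real k"
        using k by (simp add: field_simps)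
      ultimately show ?thesis using sl_small[of p] sl_small[of q] unfolding \<theta>_def by linarith
    qed
  next
    fix p q :: int assume pq: "q div int l \<le> p div int l + int h"
    then have "real_of_int (q div int l) \<le> real_of_int (p div int l) + real h" by linarith
    then have "2 * pi / real k * real_of_int (q div int l) \<le> 2 * pi / real k * (real_of_int (p div int l) + real h)"
      using k by (intro mult_left_mono) auto
    then have "2 * pi * real_of_int (q div int l) / real k
        \<le> 2 * pi * real_of_int (p div int l) / real k + 2 * pi * real h / real k"
      by (simp add: algebra_simps add_divide_distrib)
    \<comment> \<open>The origin of the bound \<open>pi / (2 * real k)\<close>: \<open>h\<close>
      steps of the \<open>k\<close>-gon and two maximal deviations make exactly a half turn, and the
      deviations are strictly smaller.\<close>
    moreover have "2 * pi * real h / real k + pi / (2 * real k) + pi / (2 * real k) = pi"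
    proof -
      have "2 * pi * real h / real k + pi / (2 * real k) + pi / (2 * real k) = pi * (2 * real h + 1) / real k"
        using k by (simp add: field_simps)
      also have "2 * real h + 1 = real k" by (simp add: kh)
      finally show ?thesis using k by simp
    qed
    ultimately show "\<theta> q - \<theta> p < pi" using sl_small[of p] sl_small[of q] unfolding \<theta>_def by linarith
  qed
  then show ?thesis using V unfolding h_def by blast
qed

theorem theorem1:
  fixes k l n :: nat and v0 w :: complex
  assumes "odd k" and "k \<ge> 3" and "odd l" and "l \<ge> 3"
    and "n = (k * l + 1) div 2"
    and "w \<noteq> 0"
  shows "\<forall>\<^sub>F \<epsilon> in at_right 0. \<forall>V. bumpy_wheel k l v0 w \<epsilon> V \<longrightarrow>
    ((\<not> (\<exists>P. graph_partition (complete_graph V) P \<and> card P = n \<and>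
            (\<forall>T\<in>P. spanning_tree T (complete_graph V) \<and> plane_graph T)))
      \<longleftrightarrow> l > 3)"
proof -
  have "continuous (at 1) Arg" by (rule continuous_at_Arg) simp
  moreover have "pi / (2 * real k) > 0" using assms(2) by simp
  ultimately obtain d where d: "d > 0"
    "\<And>z. dist z 1 < d \<Longrightarrow> dist (Arg z) (Arg 1) < pi / (2 * real k)"
    unfolding continuous_at_eps_delta by blast
  show ?thesis
    unfolding eventually_at_right_field
  \<comment> \<open>The tolerance \<open>d\<close> for \<open>Arg\<close> at \<open>1\<close> is
    scaled to the circumradius \<open>cmod w\<close>.\<close>
  proof (intro exI[of _ "d * cmod w"] conjI allI impI)
    show "0 < d * cmod w" using d assms(6) by simp
  next
    fix \<epsilon> V assume eps: "0 < \<epsilon>" "\<epsilon> < d * cmod w" and bw: "bumpy_wheel k l v0 w \<epsilon> V"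
    have small: "\<bar>Arg z\<bar> < pi / (2 * real k)" if "cmod (z - 1) \<le> \<epsilon> / cmod w" for z
    proof -
      have "\<epsilon> / cmod w < d" using eps assms(6) by (simp add: divide_less_eq)
      then have "dist z 1 < d" using that by (simp add: dist_norm)
      then show ?thesis using d(2) by (simp add: dist_real_def)
    qed
    obtain P \<rho> \<theta> where "wheel_points (int (k div 2)) (int l) (int (k * l)) (int (k div 2 * l)) P v0 \<rho> \<theta>"
      and V: "insert v0 (range P) = V"
      using bumpy_wheel_points[OF bw assms(1,2,4,6) small] by blast
    then interpret wheel "int (k div 2)" "int l" "int (k * l)" "int (k div 2 * l)" P v0
      using wheel_points.wheel by blast
    have V': "local.V = V" using V V_def by simp
    \<comment> \<open>Oddness makes the division in \<open>n\<close> exact, so that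
      \<open>card \<T> = n\<close> can be written as
      \<open>2 * card \<T> = k * l + 1\<close>.\<close>
    have "odd (k * l)" using assms by simp
    then have n: "2 * n = k * l + 1" using assms(5) by simp
    have n_iff: "card \<T> = n \<longleftrightarrow> 2 * int (card \<T>) = int (k * l) + 1" for \<T> :: "complex graph set"
      using n by linarith
    show "(\<not> (\<exists>P. graph_partition (complete_graph V) P \<and> card P = n \<and>
            (\<forall>T\<in>P. spanning_tree T (complete_graph V) \<and> plane_graph T))) \<longleftrightarrow> l > 3"
    proof
      assume neg: "\<not> (\<exists>P. graph_partition (complete_graph V) P \<and> card P = n \<and>
            (\<forall>T\<in>P. spanning_tree T (complete_graph V) \<and> plane_graph T))"
      show "l > 3"
      proof (rule ccontr)
        assume "\<not> l > 3"
        then have "int l = 3" using assms(4) by simp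
        from partition_if_l_eq_3[OF this] show False using neg n_iff unfolding V' by blast
      qed
    next
      assume l: "l > 3"
      show "\<not> (\<exists>P. graph_partition (complete_graph V) P \<and> card P = n \<and>
            (\<forall>T\<in>P. spanning_tree T (complete_graph V) \<and> plane_graph T))"
      proof
        assume "\<exists>P. graph_partition (complete_graph V) P \<and> card P = n \<and>
            (\<forall>T\<in>P. spanning_tree T (complete_graph V) \<and> plane_graph T)"
        then have "int l \<le> 3" using l_le_3_if_partition n_iff unfolding V' by blast
        then show False using l by simp
      qed
    qed
  qed
qed

end
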